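(* For each $n$, let $t^{(n)}$ be a cycle type of size $n$ and let $\tau_n$ be a uniformly random $t^{(n)}$-cyclic permutation. Write $\check n:=n-t_1^{(n)}$ for the number of non-fixed points. Suppose that $\check n\to\infty$ as $n\to\infty$ and that $$\frac{\check n}{n/\sqrt{\log n}}\underset{n\to\infty}{\longrightarrow}\alpha$$ for some $\alpha\in[0,\infty]$. Then we have the following convergence in distribution: $$\frac{\mathrm{rec}^\uparrow(\tau_n)-\log\check n}{t_1^{(n)}/\check n+\sqrt{\log\check n}}\underset{n\to\infty}{\longrightarrow}\frac{\alpha}{\alpha+1}Y+\frac{1}{\alpha+1}\Gamma_2,$$ where $Y$ and $\Gamma_2$ are independent random variables with respective laws $\mathcal{N}(0,1)$ and $\mathrm{Gamma}(2,1)$ (and where for $\alpha=\infty$ one reads $\frac{\alpha}{\alpha+1}=1$, $\frac{1}{\alpha+1}=0$). In particular, if $\frac{\check n}{n/\sqrt{\log n}}\to\infty$ as $n\to\infty$, then $$\frac{\mathrm{rec}^\uparrow(\tau_n)-\log n}{\sqrt{\log n}}\underset{n\to\infty}{\longrightarrow}\mathcal{N}(0,1)$$ in distribution.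
   Context: A cycle type of size $n$ is a sequence $t=(t_1,\dots,t_n)$ of nonnegative integers with $\sum_{p=1}^n p\,t_p=n$; a permutation of $[n]=\{1,\dots,n\}$ is $t$-cyclic if it has exactly $t_p$ cycles of length $p$ for every $p$ (fixed points are $1$-cycles). $\mathrm{rec}^\uparrow(\tau)$ is the number of high records (left-to-right maxima) of $\tau$, i.e. of $i\in[n]$ such that $\tau(j)<\tau(i)$ for all $j<i$. $\mathrm{Gamma}(2,1)$ is the law of the sum of two independent exponential random variables of parameter $1$. *)

theory Defs
  imports "HOL-Probability.Probability" "HOL-Combinatorics.Combinatorics"
begin

text \<open>A sequence \<open>(t\<^sub>1, \<dots>, t\<^sub>n)\<close> is a function on \<^typ>\<open>nat\<close> of which only the values at \<open>1, \<dots>, n\<close> matter.\<close>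

definition cycle_type :: "nat \<Rightarrow> (nat \<Rightarrow> nat) \<Rightarrow> bool" where
  "cycle_type n t \<longleftrightarrow> (\<Sum>p=1..n. p * t p) = n"

text \<open>The cycles of a permutation of \<open>{1..n}\<close> are identified with their supports, the orbits;
  a fixed point has a singleton orbit.\<close>

definition num_cycles :: "nat \<Rightarrow> (nat \<Rightarrow> nat) \<Rightarrow> nat \<Rightarrow> nat" where
  "num_cycles n \<tau> p = card {C \<in> orbit \<tau> ` {1..n}. card C = p}"

definition cyclic_perms :: "nat \<Rightarrow> (nat \<Rightarrow> nat) \<Rightarrow> (nat \<Rightarrow> nat) set" where
  "cyclic_perms n t = {\<tau>. \<tau> permutes {1..n} \<and> (\<forall>p\<in>{1..n}. num_cycles n \<tau> p = t p)}"

definition high_records :: "nat \<Rightarrow> (nat \<Rightarrow> nat) \<Rightarrow> nat" where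
  "high_records n \<tau> = card {i \<in> {1..n}. \<forall>j\<in>{1..n}. j < i \<longrightarrow> \<tau> j < \<tau> i}"

text \<open>For a cycle type of size \<open>n \<ge> 1\<close> one has \<open>t 1 \<le> n\<close>, so the subtraction does not truncate.\<close>

definition nonfixed :: "nat \<Rightarrow> (nat \<Rightarrow> nat) \<Rightarrow> nat" where
  "nonfixed n t = n - t 1"

text \<open>The law of \<open>f \<tau>\<close> for \<open>\<tau>\<close> uniformly random in \<open>cyclic_perms n t\<close>.\<close>

definition cyclic_law :: "nat \<Rightarrow> (nat \<Rightarrow> nat) \<Rightarrow> ((nat \<Rightarrow> nat) \<Rightarrow> real) \<Rightarrow> real measure" where
  "cyclic_law n t f = distr (measure_pmf (pmf_of_set (cyclic_perms n t))) borel f"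

definition gamma_2_1 :: "real measure" where
  "gamma_2_1 = convolution (density lborel (exponential_density 1)) (density lborel (exponential_density 1))"

text \<open>The weights \<open>\<alpha> / (\<alpha> + 1)\<close> and \<open>1 / (\<alpha> + 1)\<close> for \<open>\<alpha> \<in> [0, \<infinity>]\<close>.\<close>

definition weight_normal :: "ereal \<Rightarrow> real" where
  "weight_normal \<alpha> = (if \<alpha> = \<infinity> then 1 else real_of_ereal \<alpha> / (real_of_ereal \<alpha> + 1))"

definition weight_gamma :: "ereal \<Rightarrow> real" where
  "weight_gamma \<alpha> = (if \<alpha> = \<infinity> then 0 else 1 / (real_of_ereal \<alpha> + 1))"

end

theory Submission
  imports Defs "HOL-Real_Asymp.Real_Asymp"
begin

text \<open>
  Let \<open>A\<close> be the set of the non-fixed points of \<open>\<tau>\<close> and \<open>m\<close> its cardinality. A record of \<open>\<tau>\<close> at \<open>i \<in> A\<close>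
  satisfies \<open>i < \<tau> i\<close>, so it depends on the restriction of \<open>\<tau>\<close> to \<open>A\<close> alone; a fixed point \<open>i\<close> is a
  record exactly when \<open>\<tau>\<close> stabilises the set of the points of \<open>A\<close> below \<open>i\<close>. Both kinds of records
  are treated given \<open>A\<close>, when the law of \<open>\<tau>\<close> is invariant under conjugation by permutations of \<open>A\<close>.

  Non-fixed points. Let \<open>I\<close> be an initial segment of \<open>A\<close> with last point \<open>a\<close> that \<open>\<tau>\<close> does not
  stabilise. The maximum of \<open>\<tau>\<close> over \<open>I\<close> exceeds \<open>a\<close>, and conjugation by the transposition of two
  points of \<open>I\<close> moves the place where it is attained from one to the other, without changing the
  records after \<open>a\<close>. Given the later records, \<open>a\<close> is therefore a record with probability
  \<open>1 / card I\<close>. Replacing the record indicators one at a time by independent Bernoulli variables of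
  parameters \<open>1, 1/2, \<dots>, 1/m\<close> costs only the probabilities that initial segments are stable
  (\<open>sum_strong_records_close\<close>).

  Stable segments. By conjugation invariance an initial segment of size \<open>k\<close> is stable with the
  mean proportion of stable sets among all \<open>k\<close>-subsets. A stable set is a union of cycles, and
  every cycle has at least two points, so that stable sets are rare: the probabilities add up to
  \<open>O(1/m)\<close> over the proper segments (\<open>sum_card_stabilizing_initial_le\<close>).

  Fixed points. Off an event of probability \<open>O(1/m)\<close>, the records among the fixed points are
  hence the fixed points below all of \<open>A\<close> or above all of \<open>A\<close>. Their number is a function of \<open>A\<close>,
  which is a uniformly random \<open>m\<close>-subset, and the approximation for the other records holds for
  every \<open>A\<close>: up to \<open>O(1/m)\<close>, the generating function of the number of records is a
  product (\<open>sum_high_records_close\<close>). Two of the \<open>m + 1\<close> gaps left by a random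
  \<open>m\<close>-subset of \<open>{1..n}\<close> have in total a binomial number of points, with a Beta\<open>(2, m - 1)\<close> random
  parameter; scaled by \<open>m / t\<^sub>1\<close> it tends to Gamma\<open>(2, 1)\<close> when \<open>t\<^sub>1 / m\<close> tends to infinity
  (\<open>mean_outer_power_limit\<close>).
  The Bernoulli sum has mean and variance close to \<open>ln m\<close> and is asymptotically normal
  (\<open>bernoulli_product_limit\<close>). Characteristic functions and the theorem of Levy then give the
  first convergence. The second is the case \<open>\<alpha> = \<infinity>\<close>, where
  \<open>ln n - ln m\<close> and \<open>t\<^sub>1 / m\<close> are negligible compared with \<open>sqrt (ln n)\<close>.
\<close>

section \<open>Permutations of a given cycle type\<close>

lemma orbit_conj:
  assumes "\<sigma> permutes A" "finite A" "bij \<rho>"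
  shows "orbit (\<rho> \<circ> \<sigma> \<circ> inv \<rho>) (\<rho> x) = \<rho> ` orbit \<sigma> x"
proof -
  have "x \<in> orbit \<sigma> x"
    using assms permutation_permutes permutation_self_in_orbit by metis
  then show ?thesis
    using orbit_inverse[of x \<sigma> "\<rho> \<circ> \<sigma> \<circ> inv \<rho>" \<rho>] assms(3) by (simp add: bij_is_inj)
qed

lemma num_cycles_conj:
  assumes "\<sigma> permutes {1..n}" "\<rho> permutes {1..n}"
  shows "num_cycles n (\<rho> \<circ> \<sigma> \<circ> inv \<rho>) p = num_cycles n \<sigma> p"
proof -
  have inj: "inj \<rho>" using assms(2) permutes_inj by blast
  have "orbit (\<rho> \<circ> \<sigma> \<circ> inv \<rho>) ` {1..n} = orbit (\<rho> \<circ> \<sigma> \<circ> inv \<rho>) ` (\<rho> ` {1..n})"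
    using permutes_image[OF assms(2)] by simp
  also have "\<dots> = (`) \<rho> ` (orbit \<sigma> ` {1..n})"
    using orbit_conj[OF assms(1) _ permutes_bij[OF assms(2)]] by (simp add: image_image)
  finally have eq: "orbit (\<rho> \<circ> \<sigma> \<circ> inv \<rho>) ` {1..n} = (`) \<rho> ` (orbit \<sigma> ` {1..n})" .
  have card: "card (\<rho> ` C) = card C" for C
    by (rule card_image[OF inj_on_subset[OF inj]]) simp
  have "{C \<in> (`) \<rho> ` (orbit \<sigma> ` {1..n}). card C = p} = (`) \<rho> ` {C \<in> orbit \<sigma> ` {1..n}. card C = p}"
    by (auto simp: card)
  moreover have "inj_on ((`) \<rho>) X" for X
    using inj by (auto simp: inj_on_def inj_image_eq_iff)
  ultimately show ?thesis
    unfolding num_cycles_def eq by (simp add: card_image)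
qed

lemma cyclic_perms_conj:
  assumes "\<sigma> \<in> cyclic_perms n t" "\<rho> permutes {1..n}"
  shows "\<rho> \<circ> \<sigma> \<circ> inv \<rho> \<in> cyclic_perms n t"
  using assms num_cycles_conj[of \<sigma> n \<rho>]
    permutes_compose[OF permutes_inv[OF assms(2)] permutes_compose[OF _ assms(2)], of \<sigma>]
  by (simp add: cyclic_perms_def comp_assoc)

lemma finite_cyclic_perms: "finite (cyclic_perms n t)"
  by (rule finite_subset[OF _ finite_permutations[of "{1..n}"]]) (auto simp: cyclic_perms_def)

lemma ex_cyclic_on:
  assumes "finite B" "B \<noteq> {}"
  shows "\<exists>c. c permutes B \<and> cyclic_on c B"
proof -
  obtain cs where cs: "set cs = B" "distinct cs" using finite_distinct_list[OF assms(1)] by blast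
  define c where "c = cycle_of_list cs"
  have len: "length cs > 0" using cs assms by auto
  have pow: "(c ^^ k) (cs ! 0) = cs ! (k mod length cs)" for k
  proof -
    have "map (c ^^ k) cs = rotate k cs" unfolding c_def using cyclic_rotation[OF cs(2)] .
    then have "map (c ^^ k) cs ! 0 = rotate k cs ! 0" by simp
    then show ?thesis using len by (simp add: nth_rotate)
  qed
  have cB: "c permutes B" unfolding c_def using cycle_permutes[of cs] cs by simp
  have "orbit c (cs ! 0) = B"
  proof
    have "cs ! 0 \<in> B" using cs len by auto
    then show "orbit c (cs ! 0) \<subseteq> B" using permutes_orbit_subset[OF cB] by blast
    show "B \<subseteq> orbit c (cs ! 0)"
    proof
      fix b assume "b \<in> B"
      then obtain i where i: "i < length cs" "b = cs ! i" using cs by (auto simp: in_set_conv_nth)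
      then have "(c ^^ (i + length cs)) (cs ! 0) = b" using pow by simp
      then show "b \<in> orbit c (cs ! 0)" unfolding orbit_altdef
        using len by (auto intro!: exI[of _ "i + length cs"])
    qed
  qed
  then show ?thesis using cB cs len unfolding cyclic_on_def by (metis nth_mem)
qed

text \<open>The uniform law on \<open>cyclic_perms n t\<close> is meaningful only if this set is nonempty. A permutation of
  given type is obtained by removing a block on which a single cycle is placed, and by induction on
  the rest.\<close>

lemma ex_perm_of_cycle_type:
  fixes A :: "'a set" and t :: "nat \<Rightarrow> nat"
  assumes "finite A" "(\<Sum>p=1..N. p * t p) = card A"
  shows "\<exists>\<sigma>. \<sigma> permutes A \<and> (\<forall>p\<in>{1..N}. card {C \<in> orbit \<sigma> ` A. card C = p} = t p)"
  using assms
proof (induction "card A" arbitrary: A t rule: less_induct)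
  case less
  show ?case
  proof (cases "A = {}")
    case True
    then have "\<forall>p\<in>{1..N}. t p = 0" using less.prems by simp
    then show ?thesis using True by (auto intro: permutes_id)
  next
    case False
    then have "card A > 0" using less.prems by (simp add: card_gt_0_iff)
    then have "\<exists>p\<in>{1..N}. t p \<noteq> 0"
    proof (rule contrapos_pp)
      assume "\<not> (\<exists>p\<in>{1..N}. t p \<noteq> 0)"
      then have "(\<Sum>p=1..N. p * t p) = 0" by simp
      then show "\<not> card A > 0" using less.prems by simp
    qed
    then obtain p where p: "p \<in> {1..N}" "t p \<noteq> 0" by blast
    have sum_split: "(\<Sum>q=1..N. q * f q) = p * f p + (\<Sum>q\<in>{1..N}-{p}. q * f q)" for f :: "nat \<Rightarrow> nat"
      using p by (subst sum.remove[of _ p]) auto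
    define t' where "t' = t(p := t p - 1)"
    have rest: "(\<Sum>q\<in>{1..N}-{p}. q * t' q) = (\<Sum>q\<in>{1..N}-{p}. q * t q)"
      by (intro sum.cong) (auto simp: t'_def)
    have "p * t p = p * t' p + p" using p by (cases "t p") (auto simp: t'_def)
    then have sum': "(\<Sum>q=1..N. q * t' q) + p = card A"
      using sum_split[of t] sum_split[of t'] rest less.prems by simp
    then obtain B where B: "B \<subseteq> A" "card B = p"
      using obtain_subset_with_card_n[of p A] by auto
    have finB: "finite B" using B less.prems finite_subset by blast
    have B0: "B \<noteq> {}" using B p by auto
    have cardAB: "card (A - B) = card A - p" using B finB by (simp add: card_Diff_subset)
    obtain c where c: "c permutes B" "cyclic_on c B" using ex_cyclic_on[OF finB B0] by blast
    obtain \<sigma> where \<sigma>: "\<sigma> permutes (A - B)"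
        "\<And>q. q\<in>{1..N} \<Longrightarrow> card {C \<in> orbit \<sigma> ` (A - B). card C = q} = t' q"
    proof -
      have "\<exists>\<sigma>. \<sigma> permutes (A - B) \<and> (\<forall>q\<in>{1..N}. card {C \<in> orbit \<sigma> ` (A - B). card C = q} = t' q)"
      proof (rule less.hyps)
        show "card (A - B) < card A" using cardAB p \<open>card A > 0\<close> by simp
        show "(\<Sum>q=1..N. q * t' q) = card (A - B)" using cardAB sum' by simp
      qed (use less.prems in simp)
      then show thesis using that by blast
    qed
    define \<tau> where "\<tau> = c \<circ> \<sigma>"
    have \<tau>A: "\<tau> permutes A" unfolding \<tau>_def
      using permutes_subset[OF c(1) B(1)] permutes_subset[OF \<sigma>(1), of A] by (auto intro: permutes_compose)
    have cycB: "cyclic_on \<tau> B" unfolding \<tau>_def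
      by (rule permutes_comp_preserves_cyclic1[OF \<sigma>(1) c(2), of B]) auto
    have orbB: "orbit \<tau> x = B" if "x \<in> B" for x using orbit_cyclic_eq3[OF cycB that] .
    have orbAB: "orbit \<tau> x = orbit \<sigma> x" if "x \<in> A - B" for x
    proof -
      have "cyclic_on \<sigma> (orbit \<sigma> x)" using cyclic_on_orbit[OF \<sigma>(1)] less.prems by blast
      moreover have sub: "orbit \<sigma> x \<subseteq> A - B" using permutes_orbit_subset[OF \<sigma>(1) that] .
      ultimately have "cyclic_on \<tau> (orbit \<sigma> x)" unfolding \<tau>_def
        by (intro permutes_comp_preserves_cyclic2[OF c(1), where B = "A - B"]) auto
      moreover have "x \<in> orbit \<sigma> x"
        using \<sigma>(1) less.prems(1) permutation_permutes permutation_self_in_orbit by (metis finite_Diff)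
      ultimately show ?thesis using orbit_cyclic_eq3 by metis
    qed
    have "orbit \<tau> ` A = insert B (orbit \<sigma> ` (A - B))"
    proof -
      have "orbit \<tau> ` A = orbit \<tau> ` B \<union> orbit \<tau> ` (A - B)" using B by (metis Diff_partition image_Un)
      moreover have "orbit \<tau> ` B = {B}" using orbB B0 by auto
      moreover have "orbit \<tau> ` (A - B) = orbit \<sigma> ` (A - B)" using orbAB by (intro image_cong) auto
      ultimately show ?thesis by simp
    qed
    moreover have "B \<notin> orbit \<sigma> ` (A - B)"
      using permutes_orbit_subset[OF \<sigma>(1)] B0 by fastforce
    ultimately have "card {C \<in> orbit \<tau> ` A. card C = q} = t q" if "q \<in> {1..N}" for q
    proof -
      have fin: "finite {C \<in> orbit \<sigma> ` (A - B). card C = q}" using less.prems by simp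
      have "{C \<in> orbit \<tau> ` A. card C = q}
          = (if q = p then insert B {C \<in> orbit \<sigma> ` (A - B). card C = q} else {C \<in> orbit \<sigma> ` (A - B). card C = q})"
        using B \<open>orbit \<tau> ` A = insert B (orbit \<sigma> ` (A - B))\<close> by auto
      then show ?thesis using \<sigma>(2)[OF that] fin \<open>B \<notin> orbit \<sigma> ` (A - B)\<close> p
        by (auto simp: t'_def)
    qed
    then show ?thesis using \<tau>A by blast
  qed
qed

lemma cyclic_perms_nonempty:
  assumes "cycle_type n t"
  shows "cyclic_perms n t \<noteq> {}"
  using ex_perm_of_cycle_type[of "{1..n}" t n] assms
  by (auto simp: cycle_type_def cyclic_perms_def num_cycles_def)

lemma card_nonfixed:
  fixes t :: "nat \<Rightarrow> nat"
  assumes "\<tau> \<in> cyclic_perms n t" "n \<ge> 1"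
  shows "card {i \<in> {1..n}. \<tau> i \<noteq> i} = nonfixed n t" "t 1 \<le> n"
proof -
  have perm: "\<tau> permutes {1..n}" using assms by (simp add: cyclic_perms_def)
  have self: "x \<in> orbit \<tau> x" for x
    using perm permutation_permutes permutation_self_in_orbit by (metis finite_atLeastAtMost)
  have "{C \<in> orbit \<tau> ` {1..n}. card C = 1} = (\<lambda>i. {i}) ` {i \<in> {1..n}. \<tau> i = i}"
  proof (intro equalityI subsetI)
    fix C assume "C \<in> {C \<in> orbit \<tau> ` {1..n}. card C = 1}"
    then obtain x where x: "x \<in> {1..n}" "C = orbit \<tau> x" "card C = 1" by auto
    then have eq: "orbit \<tau> x = {x}" using self[of x] by (metis card_1_singletonE singletonD)
    then have "\<tau> x = x" by (simp add: orbit_eq_singleton_iff)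
    then show "C \<in> (\<lambda>i. {i}) ` {i \<in> {1..n}. \<tau> i = i}" using x eq by auto
  next
    fix C assume "C \<in> (\<lambda>i. {i}) ` {i \<in> {1..n}. \<tau> i = i}"
    then obtain x where x: "C = {x}" "x \<in> {1..n}" "\<tau> x = x" by auto
    then have "C = orbit \<tau> x" by (simp add: orbit_eq_singleton_iff[THEN iffD2])
    moreover have "card C = 1" using x by simp
    ultimately show "C \<in> {C \<in> orbit \<tau> ` {1..n}. card C = 1}" using x(2) by blast
  qed
  moreover have "num_cycles n \<tau> 1 = t 1" using assms by (auto simp: cyclic_perms_def)
  ultimately have fixed: "card {i \<in> {1..n}. \<tau> i = i} = t 1"
    unfolding num_cycles_def by (simp add: card_image inj_on_def)
  have "card {i \<in> {1..n}. \<tau> i = i} + card {i \<in> {1..n}. \<tau> i \<noteq> i} = n"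
  proof -
    have "{1..n} = {i \<in> {1..n}. \<tau> i = i} \<union> {i \<in> {1..n}. \<tau> i \<noteq> i}" by blast
    then have "n = card ({i \<in> {1..n}. \<tau> i = i} \<union> {i \<in> {1..n}. \<tau> i \<noteq> i})" by (metis card_atLeastAtMost diff_Suc_1)
    also have "\<dots> = card {i \<in> {1..n}. \<tau> i = i} + card {i \<in> {1..n}. \<tau> i \<noteq> i}"
      by (rule card_Un_disjoint) auto
    finally show ?thesis by simp
  qed
  then show "card {i \<in> {1..n}. \<tau> i \<noteq> i} = nonfixed n t" "t 1 \<le> n"
    using fixed by (auto simp: nonfixed_def)
qed

section \<open>Stable sets of permutations without fixed points\<close>

text \<open>The two extreme terms are \<open>1 / M\<close>, and the at most \<open>M - 3\<close> others are at most of order \<open>1 / M\<^sup>2\<close>.\<close>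

lemma sum_inverse_binomial_le:
  assumes "M \<ge> 1"
  shows "(\<Sum>l=1..<M. 1 / real (M choose l)) \<le> 4 / real M"
proof (cases "M \<le> 3")
  case True
  then have "M = 1 \<or> M = 2 \<or> M = 3" using assms by auto
  then show ?thesis by (auto simp: eval_nat_numeral)
next
  case False
  have M: "real M \<ge> 4" using False by simp
  have pair: "2 * (M choose 2) = M * (M - 1)"
    using even_mult_iff[of M "M - 1"] False by (simp add: choose_two)
  have inner: "1 / real (M choose l) \<le> 2 / (real M * (real M - 1))" if "l \<in> {2..<M-1}" for l
  proof -
    have "M choose 2 \<le> M choose l"
    proof (cases "2 * l \<le> M")
      case True then show ?thesis using that by (intro binomial_mono) auto
    next
      case False
      have "M choose 2 \<le> M choose (M - l)" using that False by (intro binomial_mono) auto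
      moreover have "l \<le> M" using that by auto
      ultimately show ?thesis using binomial_symmetric[of l M] by simp
    qed
    moreover have "M choose 2 > 0" using False by (simp add: zero_less_binomial_iff)
    ultimately have "1 / real (M choose l) \<le> 1 / real (M choose 2)"
      by (intro frac_le) auto
    also have "2 * real (M choose 2) = real M * (real M - 1)"
      using arg_cong[OF pair, of real] False by (simp add: of_nat_diff)
    then have "1 / real (M choose 2) = 2 / (real M * (real M - 1))"
      using M by (simp add: field_simps)
    finally show ?thesis .
  qed
  have split: "{1..<M} = insert 1 (insert (M-1) {2..<M-1})" using False by auto
  have "(\<Sum>l=1..<M. 1 / real (M choose l))
      = 1 / real M + (1 / real M + (\<Sum>l\<in>{2..<M-1}. 1 / real (M choose l)))"
    unfolding split using False binomial_symmetric[of 1 M] by (subst sum.insert | simp)+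
  also have "(\<Sum>l\<in>{2..<M-1}. 1 / real (M choose l)) \<le> (\<Sum>l\<in>{2..<M-1}. 2 / (real M * (real M - 1)))"
    by (intro sum_mono inner)
  also have "\<dots> = (real M - 3) * (2 / (real M * (real M - 1)))" using False by (simp add: of_nat_diff)
  also have "\<dots> \<le> 2 / real M" using M by (simp add: field_simps)
  finally show ?thesis by simp
qed

text \<open>Unimodality of binomial coefficients, with the minimum of the two ends replaced by a sum.\<close>

lemma inverse_binomial_between:
  assumes "a \<le> k" "k + b \<le> m"
  shows "1 / real (m choose k) \<le> 1 / real (m choose a) + 1 / real (m choose b)"
proof (cases "2 * k \<le> m")
  case True
  have "m choose a \<le> m choose k" using assms True by (intro binomial_mono) auto
  moreover have "m choose a > 0" using assms by (simp add: zero_less_binomial_iff)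
  ultimately have "1 / real (m choose k) \<le> 1 / real (m choose a)" by (intro frac_le) auto
  then show ?thesis by (simp add: add_increasing2)
next
  case False
  have "m choose b \<le> m choose (m - k)" using assms False by (intro binomial_mono) auto
  then have "m choose b \<le> m choose k" using assms binomial_symmetric[of k m] by simp
  moreover have "m choose b > 0" using assms by (simp add: zero_less_binomial_iff)
  ultimately have "1 / real (m choose k) \<le> 1 / real (m choose b)" by (intro frac_le) auto
  then show ?thesis by (simp add: add_increasing)
qed

lemma binomial_mult_le: "(a choose i) * (b choose j) \<le> (a + b) choose (i + j)"
proof -
  have "(a choose i) * (b choose (i + j - i)) \<le> (\<Sum>k\<le>i+j. (a choose k) * (b choose (i + j - k)))"
    by (rule member_le_sum) auto
  then show ?thesis by (simp add: vandermonde)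
qed

text \<open>Choose a set \<open>Q\<close> of representatives of the cycles, \<open>r\<close> in number. A stable \<open>T\<close> is determined by
  \<open>T \<inter> Q\<close>, of size \<open>l\<close> say. All cycles have length at least two, so \<open>2 l \<le> card T \<le> m - 2 (r - l)\<close>,
  whence \<open>m choose card T\<close> is at least \<open>m choose 2 l\<close> or \<open>m choose 2 (r - l)\<close>. By Vandermonde these
  are at least \<open>(r choose l) (M choose l)\<close> and \<open>(r choose l) (M choose (r - l))\<close> with \<open>M = m - r \<ge> m / 2\<close>.
  The factor \<open>r choose l\<close> cancels the number of the \<open>T\<close> with \<open>card (T \<inter> Q) = l\<close>.\<close>

lemma sum_inverse_binomial_stable_le:
  assumes A: "finite A" "A \<noteq> {}" and \<sigma>: "\<sigma> permutes A" and fpf: "\<And>a. a \<in> A \<Longrightarrow> \<sigma> a \<noteq> a"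
  shows "(\<Sum>T | T \<subseteq> A \<and> T \<noteq> {} \<and> T \<noteq> A \<and> \<sigma> ` T = T. 1 / real (card A choose card T)) \<le> 16 / real (card A)"
proof -
  define m where "m = card A"
  have perm: "permutation \<sigma>" using A \<sigma> by (auto simp: permutation_permutes)
  define rep where "rep x = (SOME y. y \<in> orbit \<sigma> x)" for x
  have rep_in: "rep x \<in> orbit \<sigma> x" for x
    unfolding rep_def using permutation_self_in_orbit[OF perm, of x] by (rule someI)
  have orb_eq: "orbit \<sigma> y = orbit \<sigma> x" if "y \<in> orbit \<sigma> x" for x y
    using cyclic_on_orbit'[OF perm, of x] that by (simp add: cyclic_on_alldef)
  have rep_step: "rep (\<sigma> x) = rep x" for x
    unfolding rep_def using orb_eq[of "\<sigma> x" x] orbit.base[of \<sigma> x] by simp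
  have rep_rep: "rep (rep x) = rep x" for x
    using orb_eq[OF rep_in] unfolding rep_def by simp
  have orb_sub: "orbit \<sigma> x \<subseteq> T" if "\<sigma> ` T = T" "x \<in> T" for x T
  proof
    fix y assume "y \<in> orbit \<sigma> x"
    then show "y \<in> T" by induction (use that in auto)
  qed
  have rep_mem: "rep x \<in> T \<longleftrightarrow> x \<in> T" if "\<sigma> ` T = T" for x T
  proof -
    have "x \<in> orbit \<sigma> (rep x)"
      using orb_eq[OF rep_in, of x] permutation_self_in_orbit[OF perm, of x] by simp
    then show ?thesis using orb_sub[OF that] rep_in[of x] by blast
  qed
  define Q where "Q = rep ` A"
  define r where "r = card Q"
  have \<sigma>A: "\<sigma> ` A = A" using \<sigma> permutes_image by blast
  have QA: "Q \<subseteq> A" unfolding Q_def using rep_mem[OF \<sigma>A] by blast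
  have finQ: "finite Q" using QA A finite_subset by blast
  have rep_Q: "rep q = q" if "q \<in> Q" for q using that rep_rep unfolding Q_def by auto
  have inj\<sigma>: "inj \<sigma>" using \<sigma> permutes_inj by blast
  \<comment> \<open>The image of a representative is another point of its orbit, hence not a representative.\<close>
  have two: "2 * card (T \<inter> Q) \<le> card T" if "\<sigma> ` T = T" "T \<subseteq> A" for T
  proof -
    have fin: "finite T" using that A finite_subset by blast
    have "(T \<inter> Q) \<inter> \<sigma> ` (T \<inter> Q) = {}"
    proof (rule ccontr)
      assume "(T \<inter> Q) \<inter> \<sigma> ` (T \<inter> Q) \<noteq> {}"
      then obtain q where q: "q \<in> Q" "\<sigma> q \<in> Q" by auto
      then have "\<sigma> q = q" using rep_Q rep_step by metis
      then show False using q QA fpf by auto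
    qed
    then have "card ((T \<inter> Q) \<union> \<sigma> ` (T \<inter> Q)) = card (T \<inter> Q) + card (T \<inter> Q)"
      using fin inj\<sigma> by (simp add: card_Un_disjoint card_image inj_on_subset)
    moreover have "card ((T \<inter> Q) \<union> \<sigma> ` (T \<inter> Q)) \<le> card T"
      using that fin by (intro card_mono) auto
    ultimately show ?thesis by simp
  qed
  have mr: "2 * r \<le> m" using two[OF \<sigma>A] QA by (simp add: m_def r_def Int_absorb1)
  define M where "M = m - r"
  have M: "m = r + M" "r \<le> M" using mr by (auto simp: M_def)
  have m0: "m > 0" using A by (simp add: m_def card_gt_0_iff)
  define ST where "ST = {T. T \<subseteq> A \<and> T \<noteq> {} \<and> T \<noteq> A \<and> \<sigma> ` T = T}"
  define f where "f l = (1 / real (M choose l) + 1 / real (M choose (r - l))) / real (r choose l)" for l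
  have bound: "1 / real (m choose card T) \<le> f (card (T \<inter> Q))" and range: "card (T \<inter> Q) \<in> {1..<r}"
    if "T \<in> ST" for T
  proof -
    have T: "T \<subseteq> A" "T \<noteq> {}" "T \<noteq> A" "\<sigma> ` T = T" using that by (auto simp: ST_def)
    have fin: "finite T" using T A finite_subset by blast
    have T': "\<sigma> ` (A - T) = A - T" using T \<sigma>A inj\<sigma> by (simp add: image_set_diff)
    let ?l = "card (T \<inter> Q)"
    obtain x where "x \<in> T" using T by blast
    then have "rep x \<in> T \<inter> Q" using rep_mem[OF T(4)] T by (auto simp: Q_def)
    then have l1: "?l \<ge> 1" using finQ by (metis One_nat_def Suc_leI card_gt_0_iff empty_iff finite_Int)
    obtain y where "y \<in> A - T" using T by blast
    then have "rep y \<in> (A - T) \<inter> Q" using rep_mem[OF T'] by (auto simp: Q_def)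
    then have "T \<inter> Q \<subset> Q" by blast
    then have l2: "?l < r" unfolding r_def using finQ by (simp add: psubset_card_mono)
    show "?l \<in> {1..<r}" using l1 l2 by simp
    have "(A - T) \<inter> Q = Q - (T \<inter> Q)" using QA by blast
    then have "card ((A - T) \<inter> Q) = r - ?l" unfolding r_def using finQ by (simp add: card_Diff_subset)
    then have "2 * (r - ?l) \<le> card (A - T)" using two[OF T'] by simp
    then have "card T + 2 * (r - ?l) \<le> m"
      unfolding m_def using T fin A by (metis add.commute card_Diff_subset card_mono diff_add le_diff_conv2)
    then have "1 / real (m choose card T) \<le> 1 / real (m choose (2 * ?l)) + 1 / real (m choose (2 * (r - ?l)))"
      by (intro inverse_binomial_between two T)
    also have "1 / real (m choose (2 * ?l)) \<le> 1 / real (M choose ?l) / real (r choose ?l)"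
    proof -
      have "(r choose ?l) * (M choose ?l) \<le> m choose (2 * ?l)"
        using binomial_mult_le[of r ?l M ?l] M by (simp add: mult_2)
      then have "real (r choose ?l) * real (M choose ?l) \<le> real (m choose (2 * ?l))"
        by (metis of_nat_le_iff of_nat_mult)
      moreover have "r choose ?l > 0" "M choose ?l > 0" using l2 M by (auto simp: zero_less_binomial_iff)
      ultimately show ?thesis by (auto simp: mult.commute intro!: frac_le)
    qed
    also have "1 / real (m choose (2 * (r - ?l))) \<le> 1 / real (M choose (r - ?l)) / real (r choose ?l)"
    proof -
      have "(r choose (r - ?l)) * (M choose (r - ?l)) \<le> m choose (2 * (r - ?l))"
        using binomial_mult_le[of r "r - ?l" M "r - ?l"] M by (simp add: mult_2)
      then have "(r choose ?l) * (M choose (r - ?l)) \<le> m choose (2 * (r - ?l))"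
        using binomial_symmetric[of ?l r] l2 by simp
      then have "real (r choose ?l) * real (M choose (r - ?l)) \<le> real (m choose (2 * (r - ?l)))"
        by (metis of_nat_le_iff of_nat_mult)
      moreover have "r choose ?l > 0" "M choose (r - ?l) > 0" using l2 M by (auto simp: zero_less_binomial_iff)
      ultimately show ?thesis by (auto simp: mult.commute intro!: frac_le)
    qed
    finally show "1 / real (m choose card T) \<le> f ?l" by (simp add: f_def add_divide_distrib)
  qed
  \<comment> \<open>A stable set contains a point if and only if it contains its representative.\<close>
  have inj: "inj_on (\<lambda>T. T \<inter> Q) ST"
  proof (rule inj_onI)
    fix S T assume ST: "S \<in> ST" "T \<in> ST" "S \<inter> Q = T \<inter> Q"
    have eq: "x \<in> S \<longleftrightarrow> x \<in> T" if "x \<in> A" for x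
      using ST that rep_mem[of S x] rep_mem[of T x] by (auto simp: ST_def Q_def)
    have "S \<subseteq> A" "T \<subseteq> A" using ST by (auto simp: ST_def)
    then show "S = T" using eq by blast
  qed
  have f0: "f l \<ge> 0" for l by (simp add: f_def)
  have "(\<Sum>T\<in>ST. 1 / real (m choose card T)) \<le> (\<Sum>T\<in>ST. f (card (T \<inter> Q)))"
    by (intro sum_mono bound)
  also have "\<dots> = (\<Sum>U\<in>(\<lambda>T. T \<inter> Q) ` ST. f (card U))"
    by (simp add: sum.reindex[OF inj])
  also have "\<dots> \<le> (\<Sum>U | U \<subseteq> Q \<and> card U \<in> {1..<r}. f (card U))"
    using finQ range f0 by (intro sum_mono2) auto
  also have "\<dots> = (\<Sum>l\<in>{1..<r}. \<Sum>U | U \<in> {U. U \<subseteq> Q \<and> card U \<in> {1..<r}} \<and> card U = l. f (card U))"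
    using finQ by (intro sum.group[symmetric]) auto
  also have "\<dots> = (\<Sum>l\<in>{1..<r}. real (r choose l) * f l)"
  proof (intro sum.cong refl)
    fix l assume l: "l \<in> {1..<r}"
    have "(\<Sum>U | U \<in> {U. U \<subseteq> Q \<and> card U \<in> {1..<r}} \<and> card U = l. f (card U))
        = (\<Sum>U | U \<subseteq> Q \<and> card U = l. f l)"
      using l by (intro sum.cong) auto
    then show "(\<Sum>U | U \<in> {U. U \<subseteq> Q \<and> card U \<in> {1..<r}} \<and> card U = l. f (card U)) = real (r choose l) * f l"
      using n_subsets[OF finQ, of l] by (simp add: r_def)
  qed
  also have "\<dots> = (\<Sum>l\<in>{1..<r}. 1 / real (M choose l) + 1 / real (M choose (r - l)))"
    by (intro sum.cong) (auto simp: f_def)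
  also have "\<dots> = (\<Sum>l\<in>{1..<r}. 1 / real (M choose l)) + (\<Sum>l\<in>{1..<r}. 1 / real (M choose (r - l)))"
    by (rule sum.distrib)
  also have "(\<Sum>l\<in>{1..<r}. 1 / real (M choose (r - l))) = (\<Sum>l\<in>{1..<r}. 1 / real (M choose l))"
    by (rule sum.reindex_bij_witness[of _ "\<lambda>l. r - l" "\<lambda>l. r - l"]) auto
  also have "(\<Sum>l\<in>{1..<r}. 1 / real (M choose l)) \<le> (\<Sum>l\<in>{1..<M}. 1 / real (M choose l))"
    using M by (intro sum_mono2) auto
  also have "\<dots> \<le> 4 / real M" using M m0 by (intro sum_inverse_binomial_le) auto
  finally have "(\<Sum>T\<in>ST. 1 / real (m choose card T)) \<le> 8 / real M" by simp
  also have "8 / real M \<le> 16 / real m"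
  proof -
    have "M > 0" "real m = real r + real M" using M m0 by auto
    then show ?thesis using M(2) by (simp add: divide_simps)
  qed
  finally show ?thesis by (simp add: ST_def m_def)
qed

text \<open>This is the symmetry of a cycle type that drives the proof: the uniform law on such a finite set \<open>C\<close>
  is invariant under conjugation by permutations of \<open>A\<close>.\<close>

definition conj_closed :: "'a set \<Rightarrow> ('a \<Rightarrow> 'a) set \<Rightarrow> bool" where
  "conj_closed A C \<longleftrightarrow> (\<forall>\<sigma>\<in>C. \<sigma> permutes A \<and> (\<forall>\<rho>. \<rho> permutes A \<longrightarrow> \<rho> \<circ> \<sigma> \<circ> inv \<rho> \<in> C))"

lemma conj_closed_finite:
  assumes "conj_closed A C" "finite A"
  shows "finite C"
  by (rule finite_subset[OF _ finite_permutations[OF assms(2)]]) (use assms in \<open>auto simp: conj_closed_def\<close>)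

lemma ex_permutes_image:
  assumes "finite A" "S \<subseteq> A" "T \<subseteq> A" "card S = card T"
  shows "\<exists>\<rho>. \<rho> permutes A \<and> \<rho> ` S = T"
proof -
  have fin: "finite S" "finite T" using assms finite_subset by auto
  obtain f where f: "bij_betw f S T" using finite_same_card_bij[OF fin assms(4)] by blast
  have "card (A - S) = card (A - T)" using assms fin by (simp add: card_Diff_subset)
  then obtain g where g: "bij_betw g (A - S) (A - T)"
    using finite_same_card_bij[of "A - S" "A - T"] assms by auto
  define \<rho> where "\<rho> x = (if x \<in> S then f x else if x \<in> A then g x else x)" for x
  have \<rho>S: "bij_betw \<rho> S T" using f by (rule bij_betw_cong[THEN iffD1, rotated]) (simp add: \<rho>_def)
  moreover have "bij_betw \<rho> (A - S) (A - T)"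
    using g by (rule bij_betw_cong[THEN iffD1, rotated]) (simp add: \<rho>_def)
  ultimately have "bij_betw \<rho> (S \<union> (A - S)) (T \<union> (A - T))" by (rule bij_betw_combine) auto
  then have "bij_betw \<rho> A A" using assms by (simp add: Un_absorb1)
  then have "\<rho> permutes A" by (rule bij_imp_permutes) (use assms in \<open>auto simp: \<rho>_def\<close>)
  then show ?thesis using \<rho>S by (auto simp: bij_betw_def)
qed

lemma card_conj_le:
  assumes C: "conj_closed A C" and A: "finite A" and \<rho>: "\<rho> permutes A"
    and PQ: "\<And>\<sigma>. \<sigma> \<in> C \<Longrightarrow> P \<sigma> \<Longrightarrow> Q (\<rho> \<circ> \<sigma> \<circ> inv \<rho>)"
  shows "card {\<sigma>\<in>C. P \<sigma>} \<le> card {\<sigma>\<in>C. Q \<sigma>}"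
proof (rule card_inj_on_le)
  show "inj_on (\<lambda>\<sigma>. \<rho> \<circ> \<sigma> \<circ> inv \<rho>) {\<sigma>\<in>C. P \<sigma>}"
  proof (rule inj_onI)
    fix \<sigma> \<sigma>' assume eq: "\<rho> \<circ> \<sigma> \<circ> inv \<rho> = \<rho> \<circ> \<sigma>' \<circ> inv \<rho>"
    show "\<sigma> = \<sigma>'"
    proof
      fix x
      have "\<rho> (\<sigma> x) = \<rho> (\<sigma>' x)" using fun_cong[OF eq, of "\<rho> x"] permutes_inverses(2)[OF \<rho>] by simp
      then show "\<sigma> x = \<sigma>' x" using permutes_inverses(2)[OF \<rho>] by metis
    qed
  qed
  show "(\<lambda>\<sigma>. \<rho> \<circ> \<sigma> \<circ> inv \<rho>) ` {\<sigma>\<in>C. P \<sigma>} \<subseteq> {\<sigma>\<in>C. Q \<sigma>}"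
    using C \<rho> PQ by (auto simp: conj_closed_def)
  show "finite {\<sigma>\<in>C. Q \<sigma>}" using conj_closed_finite[OF C A] by simp
qed

lemma card_stabilizing_eq:
  assumes C: "conj_closed A C" and A: "finite A" "S \<subseteq> A" "T \<subseteq> A" "card S = card T"
  shows "card {\<sigma>\<in>C. \<sigma> ` S = S} = card {\<sigma>\<in>C. \<sigma> ` T = T}"
proof -
  have le: "card {\<sigma>\<in>C. \<sigma> ` S = S} \<le> card {\<sigma>\<in>C. \<sigma> ` T = T}"
    if ST: "S \<subseteq> A" "T \<subseteq> A" "card S = card T" for S T
  proof -
    obtain \<rho> where \<rho>: "\<rho> permutes A" "\<rho> ` S = T" using ex_permutes_image[OF A(1) ST] by blast
    have "inv \<rho> ` T = S" using \<rho>(2) permutes_inverses(2)[OF \<rho>(1)] by (auto simp: image_image)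
    then show ?thesis using \<rho> by (intro card_conj_le[OF C A(1) \<rho>(1)]) (metis image_comp)
  qed
  show ?thesis using le[of S T] le[of T S] A by simp
qed

text \<open>Enumerates \<open>A\<close> in increasing order, so that sums over initial segments become sums over their sizes.\<close>

lemma rank_bij:
  fixes A :: "'a :: linorder set"
  assumes "finite A"
  shows "bij_betw (\<lambda>a. card (A \<inter> {..a})) A {1..card A}"
proof -
  have less: "card (A \<inter> {..a}) < card (A \<inter> {..b})" if "a \<in> A" "b \<in> A" "a < b" for a b
  proof (rule psubset_card_mono)
    have "b \<in> A \<inter> {..b}" "b \<notin> A \<inter> {..a}" "A \<inter> {..a} \<subseteq> A \<inter> {..b}" using that by auto
    then show "A \<inter> {..a} \<subset> A \<inter> {..b}" by blast
  qed (use assms in simp)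
  have "inj_on (\<lambda>a. card (A \<inter> {..a})) A"
    by (rule linorder_inj_onI) (use less in auto, use less in fastforce)
  moreover have "(\<lambda>a. card (A \<inter> {..a})) ` A \<subseteq> {1..card A}"
  proof clarify
    fix a assume "a \<in> A"
    then have "card (A \<inter> {..a}) > 0" using assms by (auto simp: card_gt_0_iff)
    moreover have "card (A \<inter> {..a}) \<le> card A" using assms by (intro card_mono) auto
    ultimately show "card (A \<inter> {..a}) \<in> {1..card A}" by simp
  qed
  ultimately have "(\<lambda>a. card (A \<inter> {..a})) ` A = {1..card A}"
    by (intro card_subset_eq) (auto simp: card_image)
  then show ?thesis using \<open>inj_on _ A\<close> by (simp add: bij_betw_def)
qed

text \<open>All \<open>k\<close>-subsets of \<open>A\<close> are stabilised by equally many elements of \<open>C\<close>. An initial segment can thus be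
  replaced by the average over the subsets of its size, and exchanging the two sums leaves for
  each permutation the sum over its stable sets.\<close>

lemma sum_card_stabilizing_initial_le:
  fixes A :: "'a :: linorder set"
  assumes C: "conj_closed A C" and A: "finite A" "A \<noteq> {}"
    and fpf: "\<And>\<sigma> a. \<sigma> \<in> C \<Longrightarrow> a \<in> A \<Longrightarrow> \<sigma> a \<noteq> a"
  shows "(\<Sum>a\<in>A-{Max A}. real (card {\<sigma>\<in>C. \<sigma> ` (A \<inter> {..a}) = A \<inter> {..a}}))
    \<le> 16 / real (card A) * real (card C)"
proof -
  define m where "m = card A"
  define N where "N T = real (card {\<sigma>\<in>C. \<sigma> ` T = T})" for T
  define rk where "rk a = card (A \<inter> {..a})" for a
  define P where "P = {T. T \<subseteq> A \<and> T \<noteq> {} \<and> T \<noteq> A}"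
  have finP: "finite P" using A by (simp add: P_def)
  have finC: "finite C" using conj_closed_finite[OF C A(1)] .
  have rk: "rk a \<in> {1..<m}" if "a \<in> A - {Max A}" for a
  proof -
    have "a < Max A" using that Max_ge[OF A(1)] by (metis DiffD1 DiffD2 insertI1 order_less_le)
    then have "Max A \<in> A" "Max A \<notin> A \<inter> {..a}" using Max_in[OF A] by auto
    then have "A \<inter> {..a} \<subset> A" by blast
    then have "rk a < m" unfolding rk_def m_def using A by (intro psubset_card_mono)
    moreover have "rk a > 0" unfolding rk_def using that A by (auto simp: card_gt_0_iff)
    ultimately show ?thesis by simp
  qed
  have N_avg: "N (A \<inter> {..a}) = (\<Sum>T | T \<in> P \<and> card T = rk a. N T / real (m choose card T))"
    if a: "a \<in> A - {Max A}" for a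
  proof -
    have "{T. T \<in> P \<and> card T = rk a} = {T. T \<subseteq> A \<and> card T = rk a}"
      using rk[OF a] by (auto simp: P_def m_def)
    then have "(\<Sum>T | T \<in> P \<and> card T = rk a. N T / real (m choose card T))
        = (\<Sum>T | T \<subseteq> A \<and> card T = rk a. N (A \<inter> {..a}) / real (m choose rk a))"
      using card_stabilizing_eq[OF C A(1), of "A \<inter> {..a}"]
      by (intro sum.cong) (auto simp: N_def rk_def)
    also have "\<dots> = N (A \<inter> {..a})"
      using n_subsets[OF A(1), of "rk a"] rk[OF a] by (simp add: m_def)
    finally show ?thesis by simp
  qed
  have "rk = (\<lambda>a. card (A \<inter> {..a}))" by (simp add: rk_def fun_eq_iff)
  then have "inj_on rk (A - {Max A})"
    using inj_on_subset[OF bij_betw_imp_inj_on[OF rank_bij[OF A(1)]], of "A - {Max A}"] by simp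
  then have "(\<Sum>a\<in>A-{Max A}. N (A \<inter> {..a}))
      = (\<Sum>k\<in>rk ` (A - {Max A}). \<Sum>T | T \<in> P \<and> card T = k. N T / real (m choose card T))"
    using N_avg by (simp add: sum.reindex)
  also have "\<dots> \<le> (\<Sum>k\<in>{0..m}. \<Sum>T | T \<in> P \<and> card T = k. N T / real (m choose card T))"
    using rk by (intro sum_mono2) (auto intro!: sum_nonneg simp: N_def, force)
  also have "\<dots> = (\<Sum>T\<in>P. N T / real (m choose card T))"
    using finP A by (intro sum.group) (auto simp: P_def m_def intro: card_mono)
  also have "\<dots> = (\<Sum>T\<in>P. \<Sum>\<sigma>\<in>C. if \<sigma> ` T = T then 1 / real (m choose card T) else 0)"
    using finC by (intro sum.cong) (auto simp: N_def sum.If_cases Int_def)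
  also have "\<dots> = (\<Sum>\<sigma>\<in>C. \<Sum>T\<in>P. if \<sigma> ` T = T then 1 / real (m choose card T) else 0)"
    by (rule sum.swap)
  also have "\<dots> = (\<Sum>\<sigma>\<in>C. \<Sum>T | T \<subseteq> A \<and> T \<noteq> {} \<and> T \<noteq> A \<and> \<sigma> ` T = T. 1 / real (m choose card T))"
  proof (rule sum.cong[OF refl])
    fix \<sigma>
    have "{T. T \<subseteq> A \<and> T \<noteq> {} \<and> T \<noteq> A \<and> \<sigma> ` T = T} = {T \<in> P. \<sigma> ` T = T}"
      by (auto simp only: P_def)
    then show "(\<Sum>T\<in>P. if \<sigma> ` T = T then 1 / real (m choose card T) else 0)
        = (\<Sum>T | T \<subseteq> A \<and> T \<noteq> {} \<and> T \<noteq> A \<and> \<sigma> ` T = T. 1 / real (m choose card T))"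
      by (simp only: sum.inter_filter[OF finP])
  qed
  also have "\<dots> \<le> (\<Sum>\<sigma>\<in>C. 16 / real m)"
    unfolding m_def using A C fpf
    by (intro sum_mono sum_inverse_binomial_stable_le) (auto simp: conj_closed_def)
  finally show ?thesis by (simp add: N_def m_def mult.commute)
qed

section \<open>Records of conjugation invariant permutations\<close>

text \<open>At a non-fixed point the condition \<open>a < \<sigma> a\<close> is automatic for a record. It is kept in the definition
  because conjugation by permutations of the points before \<open>a\<close> preserves it.\<close>

definition strong_record :: "'a::linorder set \<Rightarrow> ('a \<Rightarrow> 'a) \<Rightarrow> 'a \<Rightarrow> bool" where
  "strong_record A \<sigma> a \<longleftrightarrow> a < \<sigma> a \<and> (\<forall>b\<in>A. b < a \<longrightarrow> \<sigma> b < \<sigma> a)"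

text \<open>For \<open>c = a\<close> in \<open>A\<close> this is the record condition at \<open>a\<close>. Letting the place \<open>c\<close> of the maximum vary
  over the initial segment makes the symmetry between its points visible.\<close>

definition max_at :: "'a::linorder set \<Rightarrow> 'a \<Rightarrow> ('a \<Rightarrow> 'a) \<Rightarrow> 'a \<Rightarrow> bool" where
  "max_at A a \<sigma> c \<longleftrightarrow> a < \<sigma> c \<and> (\<forall>b\<in>A \<inter> {..a}. b \<noteq> c \<longrightarrow> \<sigma> b < \<sigma> c)"

lemma strong_record_iff_max_at:
  "a \<in> A \<Longrightarrow> strong_record A \<sigma> a \<longleftrightarrow> max_at A a \<sigma> a"
  unfolding strong_record_def max_at_def by (auto simp only: Int_iff atMost_iff order_le_less)

text \<open>The maximum lies beyond the segment unless the segment is stable, and it is attained once.\<close>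

lemma sum_max_at:
  fixes A :: "'a::linorder set"
  assumes "finite A" "\<sigma> permutes A" "a \<in> A"
  shows "(\<Sum>c\<in>A \<inter> {..a}. if max_at A a \<sigma> c then 1 else 0 :: complex)
       = (if \<sigma> ` (A \<inter> {..a}) = A \<inter> {..a} then 0 else 1)"
proof (cases "\<sigma> ` (A \<inter> {..a}) = A \<inter> {..a}")
  case True
  have "\<not> max_at A a \<sigma> c" if "c \<in> A \<inter> {..a}" for c
  proof -
    have "\<sigma> c \<in> A \<inter> {..a}" using True that by blast
    then show ?thesis by (auto simp: max_at_def)
  qed
  then show ?thesis using True by simp
next
  case False
  define I where "I = A \<inter> {..a}"
  have I: "finite I" "I \<noteq> {}" using assms by (auto simp: I_def)
  have inj: "inj_on \<sigma> I" using permutes_inj[OF assms(2)] inj_on_subset by blast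
  have "\<not> \<sigma> ` I \<subseteq> I"
    using False card_subset_eq[OF I(1), of "\<sigma> ` I"] card_image[OF inj] unfolding I_def by blast
  then obtain d where d: "d \<in> I" "\<sigma> d \<notin> I" by blast
  have "\<sigma> d \<in> A" using d permutes_in_image[OF assms(2)] by (auto simp: I_def)
  then have "a < \<sigma> d" using d by (auto simp: I_def)
  have "Max (\<sigma> ` I) \<in> \<sigma> ` I" using I by (intro Max_in) auto
  then obtain c where c: "c \<in> I" "\<sigma> c = Max (\<sigma> ` I)" by auto
  have cmax: "\<sigma> b \<le> \<sigma> c" if "b \<in> I" for b using that I c by simp
  have "max_at A a \<sigma> c' \<longleftrightarrow> c' = c" if "c' \<in> I" for c'
  proof
    assume "max_at A a \<sigma> c'"
    then show "c' = c" using cmax[OF that] c unfolding max_at_def I_def by (metis leD)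
  next
    assume "c' = c"
    moreover have "a < \<sigma> c" using \<open>a < \<sigma> d\<close> cmax[OF d(1)] by order
    moreover have "\<sigma> b < \<sigma> c" if "b \<in> I" "b \<noteq> c" for b
      using cmax[OF that(1)] inj_onD[OF inj, of b c] that c(1) by (auto simp: order_less_le)
    ultimately show "max_at A a \<sigma> c'" by (auto simp: max_at_def I_def)
  qed
  then have "(\<Sum>c\<in>I. if max_at A a \<sigma> c then 1 else 0 :: complex) = (\<Sum>c'\<in>I. if c' = c then 1 else 0)"
    by (intro sum.cong) auto
  also have "\<dots> = 1" using I c by simp
  finally show ?thesis using False by (simp add: I_def)
qed

text \<open>Values beyond the segment are not moved by the transposition, so that conjugation only renames
  the place of the maximum. The values inside the segment may be exchanged but stay below it.\<close>

lemma max_at_transpose: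
  assumes "max_at A a \<sigma> c" "c \<in> A \<inter> {..a}" "d \<in> A \<inter> {..a}"
  shows "max_at A a (Transposition.transpose c d \<circ> \<sigma> \<circ> Transposition.transpose c d) d"
proof -
  have gt: "a < \<sigma> c" using assms by (simp add: max_at_def)
  then have fixd: "Transposition.transpose c d (\<sigma> c) = \<sigma> c" using assms by (auto intro!: transpose_apply_other)
  have "Transposition.transpose c d (\<sigma> (Transposition.transpose c d b)) < \<sigma> c" if b: "b \<in> A \<inter> {..a}" "b \<noteq> d" for b
  proof -
    have "Transposition.transpose c d b \<in> A \<inter> {..a}" "Transposition.transpose c d b \<noteq> c"
      using assms b by (auto simp: Transposition.transpose_def)
    then have "\<sigma> (Transposition.transpose c d b) < \<sigma> c" using assms(1) by (auto simp: max_at_def)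
    then show ?thesis using gt assms by (auto simp: Transposition.transpose_def)
  qed
  then show ?thesis using gt fixd by (simp add: max_at_def)
qed

text \<open>The transposition acts on places and values that are at most \<open>a\<close>. It permutes the earlier places,
  and the exchanged values are below \<open>b\<close>, so they do not compete with the value at \<open>b\<close>.\<close>

lemma strong_record_transpose:
  assumes "strong_record A \<sigma> b" "a < b" "c \<in> A \<inter> {..a}" "d \<in> A \<inter> {..a}"
  shows "strong_record A (Transposition.transpose c d \<circ> \<sigma> \<circ> Transposition.transpose c d) b"
proof -
  have b: "Transposition.transpose c d b = b" using assms by (auto intro!: transpose_apply_other)
  have gt: "b < \<sigma> b" using assms by (simp add: strong_record_def)
  have \<sigma>b: "Transposition.transpose c d (\<sigma> b) = \<sigma> b" using assms gt by (auto intro!: transpose_apply_other)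
  have "Transposition.transpose c d (\<sigma> (Transposition.transpose c d e)) < \<sigma> b" if e: "e \<in> A" "e < b" for e
  proof -
    have "Transposition.transpose c d e \<in> A" "Transposition.transpose c d e < b"
      using assms e by (auto simp: Transposition.transpose_def)
    then have "\<sigma> (Transposition.transpose c d e) < \<sigma> b" using assms(1) by (auto simp: strong_record_def)
    then show ?thesis using gt assms by (auto simp: Transposition.transpose_def)
  qed
  then show ?thesis using gt b \<sigma>b by (simp add: strong_record_def)
qed

lemma transpose_conj_involution:
  "Transposition.transpose c d \<circ> (Transposition.transpose c d \<circ> \<sigma> \<circ> Transposition.transpose c d) \<circ> Transposition.transpose c d = \<sigma>"
  by (simp add: fun_eq_iff)

lemma transpose_conj_bij_betw:
  assumes "conj_closed A C" "c \<in> A" "d \<in> A"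
  shows "bij_betw (\<lambda>\<sigma>. Transposition.transpose c d \<circ> \<sigma> \<circ> Transposition.transpose c d) C C"
proof (rule bij_betw_byWitness[where f' = "\<lambda>\<sigma>. Transposition.transpose c d \<circ> \<sigma> \<circ> Transposition.transpose c d"])
  have "Transposition.transpose c d permutes A" using assms by (simp add: permutes_swap_id)
  moreover have "inv (Transposition.transpose c d) = Transposition.transpose c d" by (simp add: inv_swap_id)
  ultimately have "Transposition.transpose c d \<circ> \<sigma> \<circ> Transposition.transpose c d \<in> C" if "\<sigma> \<in> C" for \<sigma>
    using assms(1) that unfolding conj_closed_def by metis
  then show "(\<lambda>\<sigma>. Transposition.transpose c d \<circ> \<sigma> \<circ> Transposition.transpose c d) ` C \<subseteq> C"
    and "(\<lambda>\<sigma>. Transposition.transpose c d \<circ> \<sigma> \<circ> Transposition.transpose c d) ` C \<subseteq> C" by auto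
qed (auto simp: transpose_conj_involution)

text \<open>Summed over \<open>\<sigma>\<close>, this is the generating function of the number of strong records in \<open>B\<close>. The product
  form allows one indicator to be replaced at a time.\<close>

definition record_weight :: "'a::linorder set \<Rightarrow> complex \<Rightarrow> ('a \<Rightarrow> 'a) \<Rightarrow> 'a set \<Rightarrow> complex" where
  "record_weight A z \<sigma> B = (\<Prod>b\<in>B. if strong_record A \<sigma> b then z else 1)"

lemma record_weight_eq_power:
  "finite B \<Longrightarrow> record_weight A z \<sigma> B = z ^ card {b\<in>B. strong_record A \<sigma> b}"
  by (simp add: record_weight_def prod.If_cases Int_def)

lemma norm_record_weight_le:
  assumes "cmod z \<le> 1"
  shows "cmod (record_weight A z \<sigma> B) \<le> 1"
  unfolding record_weight_def prod_norm[symmetric] by (rule prod_le_1) (use assms in auto)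

text \<open>One replacement: given the records after \<open>a\<close>, the place of the maximum over the segment of
  length \<open>k\<close> is uniform as long as the segment is not stable, so the indicator at \<open>a\<close> acts as a
  Bernoulli variable of parameter \<open>1 / k\<close>.\<close>

lemma sum_record_weight_step:
  fixes A :: "'a::linorder set" and z :: complex
  assumes C: "conj_closed A C" and A: "finite A" "a \<in> A" and z: "cmod z \<le> 1"
  defines "k \<equiv> real (card (A \<inter> {..a}))"
  shows "cmod ((\<Sum>\<sigma>\<in>C. record_weight A z \<sigma> (A \<inter> {a..}))
       - (1 + (z - 1) / k) * (\<Sum>\<sigma>\<in>C. record_weight A z \<sigma> (A \<inter> {a<..})))
     \<le> 2 / k * real (card {\<sigma>\<in>C. \<sigma> ` (A \<inter> {..a}) = A \<inter> {..a}})"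
proof -
  define W where "W \<sigma> = record_weight A z \<sigma> (A \<inter> {a<..})" for \<sigma>
  define I where "I = A \<inter> {..a}"
  define S where "S = {\<sigma>\<in>C. \<sigma> ` I = I}"
  have finC: "finite C" using conj_closed_finite[OF C A(1)] .
  have I: "finite I" "a \<in> I" using A by (auto simp: I_def)
  have k: "k = real (card I)" "k > 0" using I by (auto simp: k_def I_def card_gt_0_iff)
  have W_split: "record_weight A z \<sigma> (A \<inter> {a..}) = (1 + (z - 1) * (if max_at A a \<sigma> a then 1 else 0)) * W \<sigma>" for \<sigma>
  proof -
    have "A \<inter> {a..} = insert a (A \<inter> {a<..})" using A by auto
    then show ?thesis
      using A by (simp add: record_weight_def W_def strong_record_iff_max_at)
  qed
  have W_conj: "W (Transposition.transpose c d \<circ> \<sigma> \<circ> Transposition.transpose c d) = W \<sigma>" if "c \<in> I" "d \<in> I" for c d \<sigma>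
  proof -
    have "strong_record A (Transposition.transpose c d \<circ> \<sigma> \<circ> Transposition.transpose c d) b \<longleftrightarrow> strong_record A \<sigma> b" if "a < b" for b
      using strong_record_transpose[of A \<sigma> b a c d]
        strong_record_transpose[of A "Transposition.transpose c d \<circ> \<sigma> \<circ> Transposition.transpose c d" b a c d]
        that \<open>c \<in> I\<close> \<open>d \<in> I\<close>
      unfolding transpose_conj_involution by (auto simp: I_def)
    then show ?thesis unfolding W_def record_weight_def by (intro prod.cong) auto
  qed
  have swap: "(\<Sum>\<sigma>\<in>C. (if max_at A a \<sigma> c then 1 else 0) * W \<sigma>) = (\<Sum>\<sigma>\<in>C. (if max_at A a \<sigma> a then 1 else 0) * W \<sigma>)"
    if c: "c \<in> I" for c
  proof -
    let ?T = "\<lambda>\<sigma>. Transposition.transpose c a \<circ> \<sigma> \<circ> Transposition.transpose c a"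
    have "max_at A a (?T \<sigma>) a \<longleftrightarrow> max_at A a \<sigma> c" for \<sigma>
    proof
      assume "max_at A a (?T \<sigma>) a"
      then have "max_at A a (Transposition.transpose a c \<circ> ?T \<sigma> \<circ> Transposition.transpose a c) c"
        by (rule max_at_transpose) (use c I in \<open>auto simp: I_def\<close>)
      then show "max_at A a \<sigma> c"
        unfolding transpose_commute[of a c] transpose_conj_involution .
    qed (use c I in \<open>auto simp: I_def intro!: max_at_transpose\<close>)
    then have "(\<Sum>\<sigma>\<in>C. (if max_at A a \<sigma> c then 1 else 0) * W \<sigma>)
        = (\<Sum>\<sigma>\<in>C. (if max_at A a (?T \<sigma>) a then 1 else 0) * W (?T \<sigma>))"
      using W_conj[OF c I(2)] by simp
    also have "\<dots> = (\<Sum>\<sigma>\<in>C. (if max_at A a \<sigma> a then 1 else 0) * W \<sigma>)"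
      using c A by (intro sum.reindex_bij_betw transpose_conj_bij_betw[OF C]) (auto simp: I_def)
    finally show ?thesis .
  qed
  have "k * (\<Sum>\<sigma>\<in>C. (if max_at A a \<sigma> a then 1 else 0) * W \<sigma>)
      = (\<Sum>c\<in>I. \<Sum>\<sigma>\<in>C. (if max_at A a \<sigma> c then 1 else 0) * W \<sigma>)"
    using swap k by simp
  also have "\<dots> = (\<Sum>\<sigma>\<in>C. (\<Sum>c\<in>I. if max_at A a \<sigma> c then 1 else 0) * W \<sigma>)"
    by (subst sum.swap) (simp add: sum_distrib_right)
  also have "\<dots> = (\<Sum>\<sigma>\<in>C. (1 - (if \<sigma> \<in> S then 1 else 0)) * W \<sigma>)"
    using C A by (intro sum.cong) (auto simp: sum_max_at conj_closed_def I_def S_def)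
  also have "\<dots> = (\<Sum>\<sigma>\<in>C. W \<sigma>) - (\<Sum>\<sigma>\<in>C. if \<sigma> \<in> S then W \<sigma> else 0)"
    by (simp add: left_diff_distrib sum_subtractf if_distrib[of "\<lambda>x. x * _"] cong: if_cong)
  also have "(\<Sum>\<sigma>\<in>C. if \<sigma> \<in> S then W \<sigma> else 0) = (\<Sum>\<sigma>\<in>S. W \<sigma>)"
    using finC by (simp add: sum.If_cases S_def Int_def)
  finally have key: "k * (\<Sum>\<sigma>\<in>C. (if max_at A a \<sigma> a then 1 else 0) * W \<sigma>) = (\<Sum>\<sigma>\<in>C. W \<sigma>) - (\<Sum>\<sigma>\<in>S. W \<sigma>)" .
  then have key': "(\<Sum>\<sigma>\<in>C. (if max_at A a \<sigma> a then 1 else 0) * W \<sigma>) = ((\<Sum>\<sigma>\<in>C. W \<sigma>) - (\<Sum>\<sigma>\<in>S. W \<sigma>)) / k"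
    using k by (simp add: field_simps)
  have "(\<Sum>\<sigma>\<in>C. record_weight A z \<sigma> (A \<inter> {a..}))
      = (\<Sum>\<sigma>\<in>C. W \<sigma>) + (z - 1) * (\<Sum>\<sigma>\<in>C. (if max_at A a \<sigma> a then 1 else 0) * W \<sigma>)"
    unfolding W_split by (simp add: distrib_right sum.distrib sum_distrib_left mult.assoc)
  then have "(\<Sum>\<sigma>\<in>C. record_weight A z \<sigma> (A \<inter> {a..})) - (1 + (z - 1) / k) * (\<Sum>\<sigma>\<in>C. W \<sigma>)
      = - ((z - 1) / k) * (\<Sum>\<sigma>\<in>S. W \<sigma>)"
    unfolding key' by (simp add: algebra_simps diff_divide_distrib add_divide_distrib)
  moreover have "cmod (- ((z - 1) / k) * (\<Sum>\<sigma>\<in>S. W \<sigma>)) \<le> 2 / k * real (card S)"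
  proof -
    have "cmod (z - 1) \<le> 2" using norm_triangle_ineq4[of z 1] z by simp
    then have "cmod (- ((z - 1) / k)) \<le> 2 / k" using k by (simp add: norm_divide divide_right_mono)
    moreover have "cmod (\<Sum>\<sigma>\<in>S. W \<sigma>) \<le> (\<Sum>\<sigma>\<in>S. 1)"
      unfolding W_def by (intro sum_norm_le norm_record_weight_le z)
    ultimately show ?thesis unfolding norm_mult using k by (intro mult_mono) auto
  qed
  ultimately show ?thesis by (simp add: W_def S_def I_def)
qed

text \<open>The factor is the convex combination of \<open>1\<close> and \<open>z\<close> with weight \<open>1 / k\<close>.\<close>

lemma norm_bernoulli_factor_le:
  assumes "cmod z \<le> 1" "k \<ge> 1"
  shows "cmod (1 + (z - 1) / real k) \<le> 1"
proof -
  have "1 + (z - 1) / real k = complex_of_real (1 - 1 / real k) + z / real k"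
    by (simp add: diff_divide_distrib)
  also have "cmod \<dots> \<le> cmod (complex_of_real (1 - 1 / real k)) + cmod (z / real k)" by (rule norm_triangle_ineq)
  also have "\<dots> \<le> (1 - 1 / real k) + 1 / real k"
    using assms unfolding norm_of_real by (intro add_mono) (auto simp: norm_divide divide_simps)
  finally show ?thesis by simp
qed

text \<open>The points of \<open>A\<close> below \<open>x\<close> have already been replaced; the factors obtained have modulus at
  most one, so that the errors of the steps just add up.\<close>

lemma sum_record_weight_hybrid:
  fixes A :: "nat set" and z :: complex
  assumes C: "conj_closed A C" and A: "finite A" and z: "cmod z \<le> 1"
  shows "cmod ((\<Sum>\<sigma>\<in>C. record_weight A z \<sigma> A)
       - (\<Prod>a\<in>A \<inter> {..<x}. 1 + (z - 1) / real (card (A \<inter> {..a}))) * (\<Sum>\<sigma>\<in>C. record_weight A z \<sigma> (A \<inter> {x..})))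
     \<le> (\<Sum>a\<in>A \<inter> {..<x}. 2 / real (card (A \<inter> {..a})) * real (card {\<sigma>\<in>C. \<sigma> ` (A \<inter> {..a}) = A \<inter> {..a}}))"
proof (induction x)
  case 0
  then show ?case by simp
next
  case (Suc x)
  have Suc_ge: "{Suc x..} = {x<..}" by auto
  show ?case
  proof (cases "x \<in> A")
    case False
    then have "A \<inter> {..<Suc x} = A \<inter> {..<x}" "A \<inter> {Suc x..} = A \<inter> {x..}"
      by (auto simp: less_Suc_eq, metis Suc_leI order_le_less)
    then show ?thesis using Suc by simp
  next
    case True
    define f where "f a = 1 + (z - 1) / real (card (A \<inter> {..a}))" for a
    define P where "P = (\<Prod>a\<in>A \<inter> {..<x}. f a)"
    define X where "X = (\<Sum>\<sigma>\<in>C. record_weight A z \<sigma> (A \<inter> {x..}))"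
    define Y where "Y = (\<Sum>\<sigma>\<in>C. record_weight A z \<sigma> (A \<inter> {x<..}))"
    define e where "e a = 2 / real (card (A \<inter> {..a})) * real (card {\<sigma>\<in>C. \<sigma> ` (A \<inter> {..a}) = A \<inter> {..a}})" for a
    have ins: "A \<inter> {..<Suc x} = insert x (A \<inter> {..<x})" using True by auto
    have f1: "cmod (f a) \<le> 1" if "a \<in> A" for a
      unfolding f_def using that A by (intro norm_bernoulli_factor_le z) (simp add: Suc_le_eq card_gt_0_iff, auto)
    have P1: "cmod P \<le> 1" unfolding P_def prod_norm[symmetric] by (rule prod_le_1) (use f1 in auto)
    have "cmod (X - f x * Y) \<le> e x"
      unfolding X_def Y_def f_def e_def using sum_record_weight_step[OF C A True z] by simp
    then have "cmod (P * (X - f x * Y)) \<le> e x"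
      unfolding norm_mult using P1 mult_mono[of "cmod P" 1 "cmod (X - f x * Y)" "e x"] by simp
    moreover have "cmod ((\<Sum>\<sigma>\<in>C. record_weight A z \<sigma> A) - P * X) \<le> (\<Sum>a\<in>A \<inter> {..<x}. e a)"
      using Suc unfolding P_def X_def f_def e_def .
    moreover have eq: "(\<Sum>\<sigma>\<in>C. record_weight A z \<sigma> A) - P * f x * Y
       = ((\<Sum>\<sigma>\<in>C. record_weight A z \<sigma> A) - P * X) + P * (X - f x * Y)" by (simp add: algebra_simps)
    ultimately have "cmod ((\<Sum>\<sigma>\<in>C. record_weight A z \<sigma> A) - P * f x * Y) \<le> (\<Sum>a\<in>A \<inter> {..<x}. e a) + e x"
      using norm_triangle_ineq[of "(\<Sum>\<sigma>\<in>C. record_weight A z \<sigma> A) - P * X" "P * (X - f x * Y)"]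
      unfolding eq by linarith
    then show ?thesis
      unfolding ins Suc_ge using A by (simp add: f_def P_def Y_def e_def mult.commute add.commute)
  qed
qed

text \<open>The whole set \<open>A\<close> is always stable and contributes the error \<open>2 / m\<close>; the proper segments contribute
  at most \<open>2 * 16 / m\<close>.\<close>

lemma sum_strong_records_close:
  fixes A :: "nat set" and z :: complex
  assumes C: "conj_closed A C" and A: "finite A" "A \<noteq> {}" and z: "cmod z \<le> 1"
    and fpf: "\<And>\<sigma> a. \<sigma> \<in> C \<Longrightarrow> a \<in> A \<Longrightarrow> \<sigma> a \<noteq> a"
  shows "cmod ((\<Sum>\<sigma>\<in>C. z ^ card {a\<in>A. strong_record A \<sigma> a}) - real (card C) * (\<Prod>i=1..card A. 1 + (z - 1) / real i))
     \<le> 34 / real (card A) * real (card C)"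
proof -
  define m where "m = card A"
  define x where "x = Suc (Max A)"
  define N where "N a = real (card {\<sigma>\<in>C. \<sigma> ` (A \<inter> {..a}) = A \<inter> {..a}})" for a
  have m: "m > 0" using A by (simp add: m_def card_gt_0_iff)
  have x: "A \<inter> {..<x} = A" "A \<inter> {x..} = {}"
    using A Max_ge[OF A(1)] by (auto simp: x_def less_Suc_eq_le) (meson not_less_eq_eq Max_ge)
  have prod: "(\<Prod>a\<in>A. 1 + (z - 1) / real (card (A \<inter> {..a}))) = (\<Prod>i=1..m. 1 + (z - 1) / real i)"
    unfolding m_def by (rule prod.reindex_bij_betw[OF rank_bij[OF A(1)]])
  have rk: "card (A \<inter> {..a}) \<ge> 1" if "a \<in> A" for a using that A by (simp add: Suc_le_eq card_gt_0_iff) auto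
  have rkM: "card (A \<inter> {..Max A}) = m"
    unfolding m_def using Max_ge[OF A(1)] by (intro arg_cong[where f = card]) auto
  have "cmod ((\<Sum>\<sigma>\<in>C. record_weight A z \<sigma> A) - (\<Prod>i=1..m. 1 + (z - 1) / real i) * real (card C))
      \<le> (\<Sum>a\<in>A. 2 / real (card (A \<inter> {..a})) * N a)"
    using sum_record_weight_hybrid[OF C A(1) z, of x] unfolding x prod N_def
    by (simp add: record_weight_def)
  also have "\<dots> = 2 / real m * N (Max A) + (\<Sum>a\<in>A-{Max A}. 2 / real (card (A \<inter> {..a})) * N a)"
    using A by (subst sum.remove[of A "Max A"]) (auto simp: rkM)
  also have "\<dots> \<le> 2 / real m * real (card C) + (\<Sum>a\<in>A-{Max A}. 2 * N a)"
  proof (intro add_mono mult_left_mono sum_mono mult_right_mono)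
    show "N (Max A) \<le> real (card C)"
      unfolding N_def using conj_closed_finite[OF C A(1)] by (intro of_nat_mono card_mono) auto
    show "2 / real (card (A \<inter> {..a})) \<le> 2" if "a \<in> A - {Max A}" for a
      using rk[of a] that by (simp add: divide_simps)
  qed (auto simp: N_def)
  also have "(\<Sum>a\<in>A-{Max A}. 2 * N a) = 2 * (\<Sum>a\<in>A-{Max A}. N a)" by (simp add: sum_distrib_left)
  also have "\<dots> \<le> 2 * (16 / real m * real (card C))"
    unfolding N_def m_def using sum_card_stabilizing_initial_le[OF C A] fpf by simp
  finally show ?thesis using A m by (simp add: m_def mult.commute record_weight_eq_power field_simps)
qed

section \<open>Records of permutations with fixed points\<close>

text \<open>If \<open>i\<close> is a record with \<open>\<tau> i < i\<close>, then \<open>\<tau>\<close> maps the \<open>i - 1\<close> points before \<open>i\<close> injectively into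
  the \<open>\<tau> i - 1\<close> values below \<open>\<tau> i\<close>, which is impossible. Records at non-fixed points are therefore
  strong, and fixed points before them have values that are too small to matter.\<close>

lemma high_records_eq:
  assumes \<tau>: "\<tau> permutes {1..n}"
  defines "A \<equiv> {i. \<tau> i \<noteq> i}"
  shows "high_records n \<tau> = card {a\<in>A. strong_record A \<tau> a}
     + card {i\<in>{1..n}-A. \<forall>j\<in>{1..n}. j < i \<longrightarrow> \<tau> j < i}"
proof -
  have A: "A \<subseteq> {1..n}" using \<tau> by (auto simp: A_def permutes_def)
  have inj: "inj_on \<tau> X" for X using permutes_inj[OF \<tau>] inj_on_subset by blast
  have up: "i < \<tau> i" if i: "i \<in> A" and rec: "\<forall>j\<in>{1..n}. j < i \<longrightarrow> \<tau> j < \<tau> i" for i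
  proof (rule ccontr)
    assume "\<not> i < \<tau> i"
    then have lt: "\<tau> i < i" using i by (auto simp: A_def)
    have "\<tau> ` {1..<i} \<subseteq> {1..<\<tau> i}"
    proof clarify
      fix j assume j: "j \<in> {1..<i}"
      then have jn: "j \<in> {1..n}" using i A by auto
      then have "\<tau> j \<in> {1..n}" using permutes_in_image[OF \<tau>] by blast
      moreover have "\<tau> j < \<tau> i" using rec j jn by simp
      ultimately show "\<tau> j \<in> {1..<\<tau> i}" by simp
    qed
    then have "card (\<tau> ` {1..<i}) \<le> card {1..<\<tau> i}" by (intro card_mono) auto
    then have "i - 1 \<le> \<tau> i - 1" using card_image[OF inj, of "{1..<i}"] by simp
    moreover have "i \<in> {1..n}" using i A by blast
    moreover from this have "\<tau> i \<in> {1..n}" using permutes_in_image[OF \<tau>] by blast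
    ultimately have "i \<le> \<tau> i" by auto
    then show False using lt by simp
  qed
  have rec_iff: "(\<forall>j\<in>{1..n}. j < i \<longrightarrow> \<tau> j < \<tau> i) \<longleftrightarrow> strong_record A \<tau> i" if i: "i \<in> A" for i
  proof
    assume "\<forall>j\<in>{1..n}. j < i \<longrightarrow> \<tau> j < \<tau> i"
    then show "strong_record A \<tau> i" using up[OF i] A by (auto simp: strong_record_def)
  next
    assume sr: "strong_record A \<tau> i"
    show "\<forall>j\<in>{1..n}. j < i \<longrightarrow> \<tau> j < \<tau> i"
    proof clarify
      fix j assume "j < i"
      then show "\<tau> j < \<tau> i"
        using sr by (cases "j \<in> A") (auto simp: strong_record_def A_def)
    qed
  qed
  have "{i \<in> {1..n}. \<forall>j\<in>{1..n}. j < i \<longrightarrow> \<tau> j < \<tau> i}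
      = {a\<in>A. strong_record A \<tau> a} \<union> {i\<in>{1..n}-A. \<forall>j\<in>{1..n}. j < i \<longrightarrow> \<tau> j < i}"
  proof (rule set_eqI)
    fix i
    show "i \<in> {i \<in> {1..n}. \<forall>j\<in>{1..n}. j < i \<longrightarrow> \<tau> j < \<tau> i} \<longleftrightarrow>
        i \<in> {a\<in>A. strong_record A \<tau> a} \<union> {i\<in>{1..n}-A. \<forall>j\<in>{1..n}. j < i \<longrightarrow> \<tau> j < i}"
    proof (cases "i \<in> A")
      case True then show ?thesis using rec_iff[OF True] A by blast
    next
      case False
      then have "\<tau> i = i" by (simp add: A_def)
      then show ?thesis using False by simp
    qed
  qed
  moreover have "finite A" using A finite_subset by blast
  ultimately show ?thesis
    unfolding high_records_def by (simp add: card_Un_disjoint disjoint_iff)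
qed

definition outer_points :: "nat \<Rightarrow> nat set \<Rightarrow> nat set" where
  "outer_points n A = {i\<in>{1..n}-A. (\<forall>a\<in>A. i < a) \<or> (\<forall>a\<in>A. a < i)}"

text \<open>A fixed point strictly between two points of \<open>A\<close> is a record only if the nonempty proper initial
  segment of \<open>A\<close> below it is stable.\<close>

lemma fixed_records_eq_outer:
  assumes \<tau>: "\<tau> permutes {1..n}"
  defines "A \<equiv> {i. \<tau> i \<noteq> i}"
  assumes A0: "A \<noteq> {}" and indec: "\<And>a. a \<in> A - {Max A} \<Longrightarrow> \<tau> ` (A \<inter> {..a}) \<noteq> A \<inter> {..a}"
  shows "{i\<in>{1..n}-A. \<forall>j\<in>{1..n}. j < i \<longrightarrow> \<tau> j < i} = outer_points n A"
proof (rule set_eqI)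
  fix i
  have A: "A \<subseteq> {1..n}" using \<tau> by (auto simp: A_def permutes_def)
  have finA: "finite A" using A finite_subset by blast
  have \<tau>A: "\<tau> a \<in> A" if "a \<in> A" for a
    using that permutes_inj[OF \<tau>] by (auto simp: A_def inj_eq)
  have inj: "inj_on \<tau> X" for X using permutes_inj[OF \<tau>] inj_on_subset by blast
  have fixpt: "\<tau> j = j" if "j \<notin> A" for j using that by (simp add: A_def)
  show "i \<in> {i\<in>{1..n}-A. \<forall>j\<in>{1..n}. j < i \<longrightarrow> \<tau> j < i} \<longleftrightarrow> i \<in> outer_points n A"
  proof (cases "i \<in> {1..n} - A")
    case True
    have "(\<forall>j\<in>{1..n}. j < i \<longrightarrow> \<tau> j < i) \<longleftrightarrow> (\<forall>a\<in>A. i < a) \<or> (\<forall>a\<in>A. a < i)"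
    proof
      assume "(\<forall>a\<in>A. i < a) \<or> (\<forall>a\<in>A. a < i)"
      then show "\<forall>j\<in>{1..n}. j < i \<longrightarrow> \<tau> j < i"
      proof
        assume h: "\<forall>a\<in>A. i < a"
        show ?thesis
        proof clarify
          fix j assume "j < i"
          then have "j \<notin> A" using h by auto
          then show "\<tau> j < i" using fixpt \<open>j < i\<close> by simp
        qed
      next
        assume h: "\<forall>a\<in>A. a < i"
        show ?thesis
        proof clarify
          fix j assume "j < i"
          then show "\<tau> j < i" using h \<tau>A[of j] fixpt[of j] by (cases "j \<in> A") auto
        qed
      qed
    next
      assume rec: "\<forall>j\<in>{1..n}. j < i \<longrightarrow> \<tau> j < i"
      show "(\<forall>a\<in>A. i < a) \<or> (\<forall>a\<in>A. a < i)"
      proof (rule ccontr)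
        assume neg: "\<not> ((\<forall>a\<in>A. i < a) \<or> (\<forall>a\<in>A. a < i))"
        define B where "B = A \<inter> {..<i}"
        obtain a1 where a1: "a1 \<in> A" "a1 \<le> i" using neg by (meson not_le)
        then have "a1 \<in> B" using True by (cases "a1 = i") (auto simp: B_def)
        then have B0: "finite B" "B \<noteq> {}" using finA by (auto simp: B_def)
        obtain a2 where a2: "a2 \<in> A" "i \<le> a2" using neg by (meson not_le)
        define a where "a = Max B"
        have aB: "a \<in> B" unfolding a_def using B0 by (rule Max_in)
        have "a < a2" using aB a2 by (auto simp: B_def)
        then have "a \<noteq> Max A" using a2 Max_ge[OF finA a2(1)] by auto
        then have a: "a \<in> A - {Max A}" using aB by (auto simp: B_def)
        have Ba: "A \<inter> {..a} = B"
        proof (rule set_eqI)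
          fix x show "x \<in> A \<inter> {..a} \<longleftrightarrow> x \<in> B"
            using aB Max_ge[OF B0(1), of x] by (auto simp: B_def a_def)
        qed
        have "\<tau> ` B \<subseteq> B" using rec \<tau>A A by (auto simp: B_def)
        then have "\<tau> ` B = B" using B0 card_image[OF inj] by (intro card_subset_eq) auto
        then show False using indec[OF a] Ba by simp
      qed
    qed
    then show ?thesis using True by (auto simp: outer_points_def)
  qed (auto simp: outer_points_def)
qed

lemma conj_closed_cyclic_perms: "conj_closed {1..n} (cyclic_perms n t)"
proof -
  have "\<sigma> permutes {1..n}" if "\<sigma> \<in> cyclic_perms n t" for \<sigma>
    using that by (simp add: cyclic_perms_def)
  then show ?thesis unfolding conj_closed_def using cyclic_perms_conj by blast
qed

lemma support_conj:
  assumes "bij \<rho>"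
  shows "{i. (\<rho> \<circ> \<tau> \<circ> inv \<rho>) i \<noteq> i} = \<rho> ` {i. \<tau> i \<noteq> i}"
proof (rule set_eqI)
  fix i
  obtain j where j: "i = \<rho> j" using bij_is_surj[OF assms] by (metis surjD)
  have inv: "inv \<rho> (\<rho> j) = j" and inj: "\<And>x y. \<rho> x = \<rho> y \<longleftrightarrow> x = y"
    using bij_is_inj[OF assms] by (auto simp: inj_eq)
  show "i \<in> {i. (\<rho> \<circ> \<tau> \<circ> inv \<rho>) i \<noteq> i} \<longleftrightarrow> i \<in> \<rho> ` {i. \<tau> i \<noteq> i}"
    unfolding j using inv inj by auto
qed

text \<open>Conditioning on the support keeps the invariance under the permutations of that support.\<close>

lemma conj_closed_support_class:
  assumes "A \<subseteq> {1..n}"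
  shows "conj_closed A {\<tau> \<in> cyclic_perms n t. {i. \<tau> i \<noteq> i} = A}"
  unfolding conj_closed_def
proof (intro ballI conjI allI impI)
  fix \<sigma> assume \<sigma>: "\<sigma> \<in> {\<tau> \<in> cyclic_perms n t. {i. \<tau> i \<noteq> i} = A}"
  then have "\<sigma> permutes {1..n}" by (simp add: cyclic_perms_def)
  then show "\<sigma> permutes A" by (rule permutes_superset) (use \<sigma> in blast)
  fix \<rho> assume \<rho>: "\<rho> permutes A"
  then have \<rho>n: "\<rho> permutes {1..n}" using permutes_subset assms by blast
  show "\<rho> \<circ> \<sigma> \<circ> inv \<rho> \<in> {\<tau> \<in> cyclic_perms n t. {i. \<tau> i \<noteq> i} = A}"
    using \<sigma> cyclic_perms_conj[OF _ \<rho>n, of \<sigma> t] permutes_image[OF \<rho>]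
    by (simp add: support_conj[OF permutes_bij[OF \<rho>], unfolded comp_apply])
qed

text \<open>The support of a uniformly random permutation of given type is thus a uniformly random set of
  its size.\<close>

lemma card_support_class_eq:
  assumes "A \<subseteq> {1..n}" "B \<subseteq> {1..n}" "card A = card B"
  shows "card {\<tau> \<in> cyclic_perms n t. {i. \<tau> i \<noteq> i} = A} = card {\<tau> \<in> cyclic_perms n t. {i. \<tau> i \<noteq> i} = B}"
proof -
  have le: "card {\<tau> \<in> cyclic_perms n t. {i. \<tau> i \<noteq> i} = A} \<le> card {\<tau> \<in> cyclic_perms n t. {i. \<tau> i \<noteq> i} = B}"
    if AB: "A \<subseteq> {1..n}" "B \<subseteq> {1..n}" "card A = card B" for A B
  proof -
    obtain \<rho> where \<rho>: "\<rho> permutes {1..n}" "\<rho> ` A = B" using ex_permutes_image[OF _ AB] by auto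
    show ?thesis
      by (rule card_conj_le[OF conj_closed_cyclic_perms _ \<rho>(1)])
        (use support_conj[OF permutes_bij[OF \<rho>(1)]] \<rho>(2) in auto)
  qed
  show ?thesis using le[OF assms] le[of B A] assms by simp
qed

definition mean_outer_power :: "nat \<Rightarrow> nat \<Rightarrow> complex \<Rightarrow> complex" where
  "mean_outer_power n m z
    = (\<Sum>A | A \<subseteq> {1..n} \<and> card A = m. z ^ card (outer_points n A)) / real (n choose m)"

text \<open>Of the constant \<open>66\<close>, \<open>34\<close> comes from the strong records, and twice \<open>16\<close> from the event that some
  proper initial segment is stable, on which the two powers of \<open>z\<close> differ by at most \<open>2\<close>.\<close>

lemma sum_high_records_support_class:
  fixes z :: complex and t :: "nat \<Rightarrow> nat"
  assumes A: "A \<subseteq> {1..n}" "A \<noteq> {}" and z: "cmod z \<le> 1"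
  defines "C \<equiv> {\<tau> \<in> cyclic_perms n t. {i. \<tau> i \<noteq> i} = A}"
  shows "cmod ((\<Sum>\<tau>\<in>C. z ^ high_records n \<tau>)
       - z ^ card (outer_points n A) * (real (card C) * (\<Prod>i=1..card A. 1 + (z - 1) / real i)))
     \<le> 66 / real (card A) * real (card C)"
proof -
  define m where "m = card A"
  have finA: "finite A" using A finite_subset by blast
  have C: "conj_closed A C" unfolding C_def by (rule conj_closed_support_class[OF A(1)])
  have finC: "finite C" using conj_closed_finite[OF C finA] .
  have fpf: "\<sigma> a \<noteq> a" if "\<sigma> \<in> C" "a \<in> A" for \<sigma> a using that by (auto simp: C_def)
  \<comment> \<open>Off this event, the records among the fixed points are the outer points.\<close>
  define Bad where "Bad = (\<Union>a\<in>A-{Max A}. {\<sigma>\<in>C. \<sigma> ` (A \<inter> {..a}) = A \<inter> {..a}})"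
  define R where "R \<tau> = z ^ card {a\<in>A. strong_record A \<tau> a}" for \<tau>
  define G where "G = z ^ card (outer_points n A)"
  have norm_pow: "cmod (z ^ k) \<le> 1" for k using z by (simp add: norm_power power_le_one)
  have BadC: "Bad \<subseteq> C" by (auto simp: Bad_def)
  have "real (card Bad) \<le> (\<Sum>a\<in>A-{Max A}. real (card {\<sigma>\<in>C. \<sigma> ` (A \<inter> {..a}) = A \<inter> {..a}}))"
    unfolding Bad_def using card_UN_le[of "A - {Max A}"] finA
    by (subst of_nat_sum[symmetric]) (intro of_nat_mono, auto)
  also have "\<dots> \<le> 16 / real m * real (card C)"
    unfolding m_def using fpf by (intro sum_card_stabilizing_initial_le[OF C finA A(2)])
  finally have Bad: "real (card Bad) \<le> 16 / real m * real (card C)" .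
  have diff: "cmod (z ^ high_records n \<tau> - G * R \<tau>) \<le> (if \<tau> \<in> Bad then 2 else 0)" if \<tau>: "\<tau> \<in> C" for \<tau>
  proof (cases "\<tau> \<in> Bad")
    case True
    have "cmod (G * R \<tau>) \<le> 1" unfolding G_def R_def power_add[symmetric] by (rule norm_pow)
    then show ?thesis
      using True norm_triangle_ineq4[of "z ^ high_records n \<tau>" "G * R \<tau>"] norm_pow[of "high_records n \<tau>"] by simp
  next
    case False
    have perm: "\<tau> permutes {1..n}" and supp: "{i. \<tau> i \<noteq> i} = A"
      using \<tau> by (auto simp: C_def cyclic_perms_def)
    have "{i\<in>{1..n}-A. \<forall>j\<in>{1..n}. j < i \<longrightarrow> \<tau> j < i} = outer_points n A"
      using fixed_records_eq_outer[OF perm] False A(2) \<tau> unfolding supp Bad_def by blast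
    then have "high_records n \<tau> = card {a\<in>A. strong_record A \<tau> a} + card (outer_points n A)"
      using high_records_eq[OF perm] unfolding supp by simp
    then show ?thesis using False by (simp add: G_def R_def power_add mult.commute)
  qed
  have "cmod ((\<Sum>\<tau>\<in>C. z ^ high_records n \<tau>) - G * (\<Sum>\<tau>\<in>C. R \<tau>))
      = cmod (\<Sum>\<tau>\<in>C. z ^ high_records n \<tau> - G * R \<tau>)"
    by (simp add: sum_subtractf sum_distrib_left)
  also have "\<dots> \<le> (\<Sum>\<tau>\<in>C. if \<tau> \<in> Bad then 2 else 0)" by (intro sum_norm_le diff)
  also have "\<dots> = 2 * real (card Bad)"
    using finC BadC by (simp add: sum.If_cases Int_absorb1)
  also have "\<dots> \<le> 32 / real m * real (card C)" using Bad by simp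
  finally have 1: "cmod ((\<Sum>\<tau>\<in>C. z ^ high_records n \<tau>) - G * (\<Sum>\<tau>\<in>C. R \<tau>)) \<le> 32 / real m * real (card C)" .
  define S where "S = (\<Sum>\<tau>\<in>C. R \<tau>)"
  define P where "P = real (card C) * (\<Prod>i=1..m. 1 + (z - 1) / real i)"
  have 2: "cmod (S - P) \<le> 34 / real m * real (card C)"
    unfolding S_def P_def R_def m_def
    using sum_strong_records_close[OF C finA A(2) z] fpf by blast
  have "cmod (G * (S - P)) \<le> 1 * (34 / real m * real (card C))"
    unfolding norm_mult using 2 norm_pow[of "card (outer_points n A)"] by (intro mult_mono) (auto simp: G_def)
  moreover have "cmod ((\<Sum>\<tau>\<in>C. z ^ high_records n \<tau>) - G * P)
      \<le> cmod ((\<Sum>\<tau>\<in>C. z ^ high_records n \<tau>) - G * S) + cmod (G * (S - P))"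
    using norm_triangle_ineq[of "(\<Sum>\<tau>\<in>C. z ^ high_records n \<tau>) - G * S" "G * (S - P)"]
    by (simp add: algebra_simps)
  moreover have "66 / real m * real (card C) = 32 / real m * real (card C) + 34 / real m * real (card C)"
    by (simp add: add_divide_distrib[symmetric] distrib_right[symmetric])
  ultimately have "cmod ((\<Sum>\<tau>\<in>C. z ^ high_records n \<tau>) - G * P) \<le> 66 / real m * real (card C)"
    using 1 unfolding S_def by linarith
  then show ?thesis by (simp add: G_def P_def m_def)
qed

text \<open>The bound for given support does not depend on the support, which makes the two kinds of
  records asymptotically independent.\<close>

lemma sum_high_records_close:
  fixes z :: complex and t :: "nat \<Rightarrow> nat"
  assumes n: "n \<ge> 1" and z: "cmod z \<le> 1"
  defines "m \<equiv> nonfixed n t"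
  assumes m: "m \<ge> 1"
  shows "cmod ((\<Sum>\<tau>\<in>cyclic_perms n t. z ^ high_records n \<tau>)
       - real (card (cyclic_perms n t)) * ((\<Prod>i=1..m. 1 + (z - 1) / real i) * mean_outer_power n m z))
     \<le> 66 / real m * real (card (cyclic_perms n t))"
proof -
  define \<A> where "\<A> = {A. A \<subseteq> {1..n} \<and> card A = m}"
  define C where "C A = {\<tau> \<in> cyclic_perms n t. {i. \<tau> i \<noteq> i} = A}" for A
  define P where "P = (\<Prod>i=1..m. 1 + (z - 1) / real i)"
  define c where "c = card (C {1..m})"
  have mn: "m \<le> n" by (simp add: m_def nonfixed_def)
  have fin: "finite (cyclic_perms n t)" "finite \<A>" by (simp_all add: finite_cyclic_perms \<A>_def)
  have supp: "{i. \<tau> i \<noteq> i} \<in> \<A>" if "\<tau> \<in> cyclic_perms n t" for \<tau>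
  proof -
    have "\<tau> permutes {1..n}" using that by (simp add: cyclic_perms_def)
    then have "{i. \<tau> i \<noteq> i} = {i\<in>{1..n}. \<tau> i \<noteq> i}" by (auto simp: permutes_def)
    then show ?thesis using card_nonfixed(1)[OF that n] by (auto simp: \<A>_def m_def)
  qed
  have cardC: "card (C A) = c" if "A \<in> \<A>" for A
    unfolding c_def C_def using that mn by (intro card_support_class_eq) (auto simp: \<A>_def)
  have group: "(\<Sum>A\<in>\<A>. \<Sum>\<tau>\<in>C A. g \<tau>) = (\<Sum>\<tau>\<in>cyclic_perms n t. g \<tau>)" for g :: "(nat \<Rightarrow> nat) \<Rightarrow> 'b::comm_monoid_add"
    unfolding C_def using fin supp by (intro sum.group) auto
  have card\<A>: "card \<A> = n choose m" using n_subsets[of "{1..n}" m] by (simp add: \<A>_def)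
  have "card (cyclic_perms n t) = (\<Sum>A\<in>\<A>. c)" using group[of "\<lambda>_. 1::nat"] cardC by simp
  then have total: "card (cyclic_perms n t) = (n choose m) * c" using card\<A> by simp
  have pos: "n choose m > 0" using mn by (simp add: zero_less_binomial_iff)
  have "real (card (cyclic_perms n t)) * (P * mean_outer_power n m z)
      = (\<Sum>A\<in>\<A>. z ^ card (outer_points n A)) * (real c * P)"
    unfolding mean_outer_power_def \<A>_def[symmetric] total using pos by simp
  then have "real (card (cyclic_perms n t)) * (P * mean_outer_power n m z)
      = (\<Sum>A\<in>\<A>. z ^ card (outer_points n A) * (real c * P))"
    by (simp only: sum_distrib_right)
  moreover have "(\<Sum>\<tau>\<in>cyclic_perms n t. z ^ high_records n \<tau>) = (\<Sum>A\<in>\<A>. \<Sum>\<tau>\<in>C A. z ^ high_records n \<tau>)"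
    by (simp add: group)
  ultimately have "(\<Sum>\<tau>\<in>cyclic_perms n t. z ^ high_records n \<tau>) - real (card (cyclic_perms n t)) * (P * mean_outer_power n m z)
      = (\<Sum>A\<in>\<A>. (\<Sum>\<tau>\<in>C A. z ^ high_records n \<tau>) - z ^ card (outer_points n A) * (real c * P))"
    by (simp add: sum_subtractf)
  also have "cmod \<dots> \<le> (\<Sum>A\<in>\<A>. 66 / real m * real c)"
  proof (rule sum_norm_le)
    fix A assume A: "A \<in> \<A>"
    then have A': "A \<subseteq> {1..n}" "A \<noteq> {}" "card A = m" using m by (auto simp: \<A>_def)
    show "cmod ((\<Sum>\<tau>\<in>C A. z ^ high_records n \<tau>) - z ^ card (outer_points n A) * (real c * P)) \<le> 66 / real m * real c"
      using sum_high_records_support_class[OF A'(1,2) z, of t] unfolding C_def[symmetric] A'(3) cardC[OF A] P_def .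
  qed
  also have "\<dots> = 66 / real m * real (card (cyclic_perms n t))" using total card\<A> by simp
  finally show ?thesis by (simp add: P_def)
qed

section \<open>The number of records of a uniform permutation\<close>

lemma norm_exp_minus_linear_le:
  fixes a :: complex
  assumes "cmod a \<le> 2"
  shows "cmod (1 + a - exp a) \<le> exp 2 * (cmod a)\<^sup>2"
proof -
  have "cmod (exp a - (1 + a)) \<le> exp (cmod a) * (cmod a)\<^sup>2"
    using Taylor_exp_field[of a 1] by (simp add: power2_eq_square)
  also have "\<dots> \<le> exp 2 * (cmod a)\<^sup>2" using assms by (intro mult_right_mono) auto
  finally show ?thesis by (simp add: norm_minus_commute)
qed

lemma norm_iexp_minus_one_le: "cmod (iexp x - 1) \<le> \<bar>x\<bar>"
  using iexp_approx1[of x 0] by simp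

lemma norm_exp_le_one: "Re a \<le> 0 \<Longrightarrow> cmod (exp a) \<le> 1"
  by simp

lemma sum_inverse_squares_le: "(\<Sum>i=1..m. 1 / (real i)\<^sup>2) \<le> pi\<^sup>2 / 6"
proof -
  have S: "(\<lambda>i. 1 / (real i + 1)\<^sup>2) sums (pi\<^sup>2 / 6)"
    using inverse_squares_sums by (simp add: add.commute)
  have "(\<Sum>i=1..m. 1 / (real i)\<^sup>2) = (\<Sum>i<m. 1 / (real i + 1)\<^sup>2)"
    by (rule sum.reindex_bij_witness[of _ Suc "\<lambda>i. i - 1"]) auto
  also have "\<dots> \<le> (\<Sum>i. 1 / (real i + 1)\<^sup>2)"
    by (rule sum_le_suminf[OF sums_summable[OF S]]) auto
  also have "\<dots> = pi\<^sup>2 / 6" using sums_unique[OF S] by simp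
  finally show ?thesis .
qed

text \<open>Poisson approximation: \<open>1 + a\<close> is replaced by \<open>exp a\<close> at cost \<open>O(\<bar>a\<bar>\<^sup>2)\<close>, and the squares of
  \<open>\<bar>\<theta>\<bar> / i\<close> are summable.\<close>

lemma bernoulli_product_approx:
  "cmod ((\<Prod>i=1..m. 1 + (iexp \<theta> - 1) / real i) - exp ((iexp \<theta> - 1) * harm m))
     \<le> exp 2 * (pi\<^sup>2 / 6) * \<theta>\<^sup>2"
proof -
  define z where "z = iexp \<theta>"
  have z: "cmod z \<le> 1" "cmod (z - 1) \<le> 2" "cmod (z - 1) \<le> \<bar>\<theta>\<bar>"
    using norm_triangle_ineq4[of z 1] norm_iexp_minus_one_le[of \<theta>] by (auto simp: z_def)
  have re: "Re (z - 1) \<le> 0" using z(1) complex_Re_le_cmod[of z] by simp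
  have "exp ((z - 1) * harm m) = (\<Prod>i=1..m. exp ((z - 1) / real i))"
    unfolding harm_def by (simp add: exp_sum sum_distrib_left divide_inverse)
  then have "cmod ((\<Prod>i=1..m. 1 + (z - 1) / real i) - exp ((z - 1) * harm m))
      \<le> (\<Sum>i=1..m. cmod (1 + (z - 1) / real i - exp ((z - 1) / real i)))"
    using norm_bernoulli_factor_le[OF z(1)] re
    by (simp only:) (intro norm_prod_diff norm_exp_le_one, auto simp: divide_nonpos_nonneg)
  also have "\<dots> \<le> (\<Sum>i=1..m. exp 2 * \<theta>\<^sup>2 * (1 / (real i)\<^sup>2))"
  proof (rule sum_mono)
    fix i assume i: "i \<in> {1..m}"
    have "cmod ((z - 1) / real i) \<le> 2" using z(2) i by (simp add: norm_divide divide_simps)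
    then have "cmod (1 + (z - 1) / real i - exp ((z - 1) / real i)) \<le> exp 2 * (cmod ((z - 1) / real i))\<^sup>2"
      by (rule norm_exp_minus_linear_le)
    also have "\<dots> = exp 2 * ((cmod (z - 1))\<^sup>2 * (1 / (real i)\<^sup>2))" by (simp add: norm_divide power_divide)
    also have "\<dots> \<le> exp 2 * (\<bar>\<theta>\<bar>\<^sup>2 * (1 / (real i)\<^sup>2))"
      using z(3) by (intro mult_left_mono mult_right_mono power_mono) auto
    finally show "cmod (1 + (z - 1) / real i - exp ((z - 1) / real i)) \<le> exp 2 * \<theta>\<^sup>2 * (1 / (real i)\<^sup>2)"
      by (simp add: mult.assoc)
  qed
  also have "\<dots> = exp 2 * \<theta>\<^sup>2 * (\<Sum>i=1..m. 1 / (real i)\<^sup>2)" by (simp add: sum_distrib_left)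
  also have "\<dots> \<le> exp 2 * \<theta>\<^sup>2 * (pi\<^sup>2 / 6)" by (intro mult_left_mono sum_inverse_squares_le) auto
  finally show ?thesis by (simp add: z_def mult_ac)
qed

text \<open>With \<open>\<theta> = u / s\<close> and \<open>L = ln m\<close>, the centred exponent is
  \<open>(iexp \<theta> - 1 - \<i> \<theta>) L + (iexp \<theta> - 1) (harm m - L)\<close>. The second term vanishes because
  \<open>harm m - ln m\<close> converges, and the first is \<open>- \<theta>\<^sup>2 L / 2 + O(\<bar>\<theta>\<bar>\<^sup>3 L)\<close> with
  \<open>\<theta>\<^sup>2 L \<longlonglongrightarrow> (w u)\<^sup>2\<close>.\<close>

lemma bernoulli_product_limit:
  fixes m :: "nat \<Rightarrow> nat" and s :: "nat \<Rightarrow> real"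
  assumes m: "filterlim m at_top sequentially" and s: "filterlim s at_top sequentially"
    and w: "(\<lambda>n. sqrt (ln (m n)) / s n) \<longlonglongrightarrow> w"
  shows "(\<lambda>n. (\<Prod>i=1..m n. 1 + (iexp (u / s n) - 1) / real i) * iexp (- (u / s n * ln (m n))))
     \<longlonglongrightarrow> complex_of_real (exp (- ((w * u)\<^sup>2 / 2)))"
proof -
  define \<theta> where "\<theta> n = u / s n" for n
  define L where "L n = ln (real (m n))" for n
  define P where "P n = (\<Prod>i=1..m n. 1 + (iexp (\<theta> n) - 1) / real i)" for n
  have \<theta>0: "\<theta> \<longlonglongrightarrow> 0" unfolding \<theta>_def[abs_def]
    using s by (intro real_tendsto_divide_at_top[OF tendsto_const])
  have m1: "eventually (\<lambda>n. m n \<ge> 1) sequentially" using m by (simp add: filterlim_at_top)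
  have sq: "(\<lambda>n. (\<theta> n)\<^sup>2 * L n) \<longlonglongrightarrow> (w * u)\<^sup>2"
  proof -
    have "(\<lambda>n. (sqrt (ln (m n)) / s n * u)\<^sup>2) \<longlonglongrightarrow> (w * u)\<^sup>2"
      by (intro tendsto_intros w)
    moreover have "eventually (\<lambda>n. (sqrt (ln (m n)) / s n * u)\<^sup>2 = (\<theta> n)\<^sup>2 * L n) sequentially"
      using m1 by eventually_elim (simp add: \<theta>_def L_def power_mult_distrib power_divide)
    ultimately show ?thesis by (rule Lim_transform_eventually)
  qed
  define r where "r n = iexp (\<theta> n) - (1 + \<i> * \<theta> n - (\<theta> n)\<^sup>2 / 2)" for n
  have r: "cmod (r n) \<le> \<bar>\<theta> n\<bar> ^ 3" for n
  proof -
    have "(\<Sum>k\<le>2. (\<i> * \<theta> n)^k / fact k) = 1 + \<i> * \<theta> n - (\<theta> n)\<^sup>2 / 2"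
      by (simp add: numeral_2_eq_2 power2_eq_square algebra_simps)
    then have "cmod (r n) \<le> \<bar>\<theta> n\<bar> ^ 3 / 6"
      using iexp_approx1[of "\<theta> n" 2] by (simp add: r_def fact_numeral eval_nat_numeral)
    also have "\<dots> \<le> \<bar>\<theta> n\<bar> ^ 3" by simp
    finally show ?thesis .
  qed
  have rL: "(\<lambda>n. r n * L n) \<longlonglongrightarrow> 0"
  proof (rule Lim_null_comparison)
    show "(\<lambda>n. \<bar>\<theta> n\<bar> * \<bar>(\<theta> n)\<^sup>2 * L n\<bar>) \<longlonglongrightarrow> 0"
      using tendsto_mult[OF tendsto_rabs[OF \<theta>0] tendsto_rabs[OF sq]] by simp
    have "cmod (r n * L n) \<le> \<bar>\<theta> n\<bar> * \<bar>(\<theta> n)\<^sup>2 * L n\<bar>" for n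
    proof -
      have "cmod (r n * L n) \<le> \<bar>\<theta> n\<bar> ^ 3 * \<bar>L n\<bar>"
        using r[of n] by (simp add: norm_mult mult_right_mono)
      also have "\<dots> = \<bar>\<theta> n\<bar> * \<bar>(\<theta> n)\<^sup>2 * L n\<bar>" by (simp add: abs_mult power3_eq_cube power2_eq_square)
      finally show ?thesis .
    qed
    then show "\<forall>\<^sub>F n in sequentially. cmod (r n * L n) \<le> \<bar>\<theta> n\<bar> * \<bar>(\<theta> n)\<^sup>2 * L n\<bar>" by simp
  qed
  have H: "(\<lambda>n. complex_of_real (harm (m n) - L n)) \<longlonglongrightarrow> complex_of_real euler_mascheroni"
    unfolding L_def
    using filterlim_compose[OF euler_mascheroni_LIMSEQ m] by (intro tendsto_of_real) simp
  have z1: "(\<lambda>n. iexp (\<theta> n) - 1) \<longlonglongrightarrow> 0"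
    by (rule Lim_null_comparison[OF _ tendsto_rabs_zero[OF \<theta>0]]) (use norm_iexp_minus_one_le in auto)
  have sqc: "(\<lambda>n. complex_of_real ((\<theta> n)\<^sup>2 * L n)) \<longlonglongrightarrow> complex_of_real ((w * u)\<^sup>2)"
    using sq by (rule tendsto_of_real)
  have "(\<lambda>n. - (complex_of_real ((\<theta> n)\<^sup>2 * L n) / 2) + r n * L n
        + (iexp (\<theta> n) - 1) * complex_of_real (harm (m n) - L n))
      \<longlonglongrightarrow> - (complex_of_real ((w * u)\<^sup>2) / 2) + 0 + 0 * complex_of_real euler_mascheroni"
    by (intro tendsto_intros sqc rL z1 H) simp
  then have "(\<lambda>n. exp (- (complex_of_real ((\<theta> n)\<^sup>2 * L n) / 2) + r n * L n
        + (iexp (\<theta> n) - 1) * complex_of_real (harm (m n) - L n)))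
      \<longlonglongrightarrow> exp (- (complex_of_real ((w * u)\<^sup>2) / 2))"
    using tendsto_exp by fastforce
  moreover have "exp (- (complex_of_real ((\<theta> n)\<^sup>2 * L n) / 2) + r n * L n
        + (iexp (\<theta> n) - 1) * complex_of_real (harm (m n) - L n))
      = exp ((iexp (\<theta> n) - 1) * harm (m n)) * iexp (- (\<theta> n * L n))" for n
  proof -
    have h: "(harm (m n) :: complex) = of_real (harm (m n))" by (simp add: of_real_harm)
    have "- (complex_of_real ((\<theta> n)\<^sup>2 * L n) / 2) + (z - (1 + \<i> * \<theta> n - (\<theta> n)\<^sup>2 / 2)) * L n
        + (z - 1) * complex_of_real (a - L n) = (z - 1) * of_real a + \<i> * of_real (- (\<theta> n * L n))" for z and a :: real
      by (simp add: algebra_simps)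
    then show ?thesis unfolding exp_add[symmetric] r_def h by (simp only:)
  qed
  ultimately have main: "(\<lambda>n. exp ((iexp (\<theta> n) - 1) * harm (m n)) * iexp (- (\<theta> n * L n)))
      \<longlonglongrightarrow> exp (- (complex_of_real ((w * u)\<^sup>2) / 2))" by simp
  have "(\<lambda>n. (P n - exp ((iexp (\<theta> n) - 1) * harm (m n))) * iexp (- (\<theta> n * L n))) \<longlonglongrightarrow> 0"
  proof (rule Lim_null_comparison)
    show "(\<lambda>n. exp 2 * (pi\<^sup>2 / 6) * (\<theta> n)\<^sup>2) \<longlonglongrightarrow> 0"
      using tendsto_mult[OF tendsto_const tendsto_power[OF \<theta>0, of 2]] by simp
    show "\<forall>\<^sub>F n in sequentially. cmod ((P n - exp ((iexp (\<theta> n) - 1) * harm (m n))) * iexp (- (\<theta> n * L n)))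
        \<le> exp 2 * (pi\<^sup>2 / 6) * (\<theta> n)\<^sup>2"
      using bernoulli_product_approx unfolding P_def norm_mult norm_exp_i_times by (simp del: of_real_minus of_real_mult)
  qed
  from tendsto_add[OF this main] have "(\<lambda>n. P n * iexp (- (\<theta> n * L n))) \<longlonglongrightarrow> exp (- (complex_of_real ((w * u)\<^sup>2) / 2))"
    by (simp add: algebra_simps)
  then show ?thesis unfolding P_def \<theta>_def L_def by (simp add: exp_of_real[symmetric])
qed

section \<open>Fixed points below or above all other points\<close>

lemma card_outer_points:
  assumes "A \<subseteq> {1..n}" "A \<noteq> {}"
  shows "card (outer_points n A) = (Min A - 1) + (n - Max A)"
proof -
  have fin: "finite A" using assms finite_subset by blast
  have mem: "Min A \<in> A" "Max A \<in> A" using fin assms by auto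
  have "outer_points n A = {1..<Min A} \<union> {Max A<..n}"
  proof (rule set_eqI)
    fix i
    have "(\<forall>a\<in>A. i < a) \<longleftrightarrow> i < Min A" "(\<forall>a\<in>A. a < i) \<longleftrightarrow> Max A < i"
      using fin assms by auto
    moreover have "i \<notin> A" if "i < Min A \<or> Max A < i" using that fin by (meson Min_le Max_ge leD)
    moreover have "1 \<le> Max A" "Min A \<le> n" using mem assms by auto
    ultimately show "i \<in> outer_points n A \<longleftrightarrow> i \<in> {1..<Min A} \<union> {Max A<..n}"
      by (auto simp: outer_points_def)
  qed
  moreover have "Min A \<le> Max A" using mem fin by simp
  moreover from this have "{1..<Min A} \<inter> {Max A<..n} = {}" by auto
  ultimately show ?thesis by (simp add: card_Un_disjoint)
qed

lemma card_subsets_Min_Max: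
  assumes "1 \<le> a" "a < b" "b \<le> n" "m \<ge> 2"
  shows "card {A. A \<subseteq> {1..n} \<and> card A = m \<and> Min A = a \<and> Max A = b} = (b - a - 1) choose (m - 2)"
proof -
  have "{A. A \<subseteq> {1..n} \<and> card A = m \<and> Min A = a \<and> Max A = b}
      = (\<lambda>B. insert a (insert b B)) ` {B. B \<subseteq> {a<..<b} \<and> card B = m - 2}"
  proof (intro equalityI subsetI)
    fix A assume "A \<in> {A. A \<subseteq> {1..n} \<and> card A = m \<and> Min A = a \<and> Max A = b}"
    then have A: "A \<subseteq> {1..n}" "card A = m" "Min A = a" "Max A = b" by auto
    have fin: "finite A" using A finite_subset by blast
    have ne: "A \<noteq> {}" using A assms by auto
    have mem: "a \<in> A" "b \<in> A" using Min_in[OF fin ne] Max_in[OF fin ne] A by auto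
    have bd: "a \<le> x" "x \<le> b" if "x \<in> A" for x using A that fin Min_le Max_ge by auto
    define B where "B = A - {a, b}"
    have "A = insert a (insert b B)" using mem by (auto simp: B_def)
    moreover have "B \<subseteq> {a<..<b}" using bd by (force simp: B_def)
    moreover have "card B = m - 2" unfolding B_def using mem fin A assms by (subst card_Diff_subset) auto
    ultimately show "A \<in> (\<lambda>B. insert a (insert b B)) ` {B. B \<subseteq> {a<..<b} \<and> card B = m - 2}" by blast
  next
    fix A assume "A \<in> (\<lambda>B. insert a (insert b B)) ` {B. B \<subseteq> {a<..<b} \<and> card B = m - 2}"
    then obtain B where B: "B \<subseteq> {a<..<b}" "card B = m - 2" "A = insert a (insert b B)" by blast
    have fin: "finite B" using B finite_subset by blast
    have "card A = m" using B fin assms by (auto simp: card_insert_if)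
    moreover have "Min A = a" using B fin assms by (intro Min_eqI) auto
    moreover have "Max A = b" using B fin assms by (intro Max_eqI) auto
    moreover have "A \<subseteq> {1..n}" using B assms by auto
    ultimately show "A \<in> {A. A \<subseteq> {1..n} \<and> card A = m \<and> Min A = a \<and> Max A = b}" by blast
  qed
  moreover have "inj_on (\<lambda>B. insert a (insert b B)) {B. B \<subseteq> {a<..<b} \<and> card B = m - 2}"
  proof (rule inj_onI)
    fix B B' assume h: "B \<in> {B. B \<subseteq> {a<..<b} \<and> card B = m - 2}" "B' \<in> {B. B \<subseteq> {a<..<b} \<and> card B = m - 2}"
      "insert a (insert b B) = insert a (insert b B')"
    have eq: "insert a (insert b X) - {a, b} = X" if "X \<subseteq> {a<..<b}" for X :: "nat set"
      using that by auto
    show "B = B'" using eq[of B] eq[of B'] h by simp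
  qed
  ultimately show ?thesis by (simp add: card_image n_subsets)
qed

text \<open>Sets \<open>A\<close> are sorted by the numbers \<open>p\<close> and \<open>q\<close> of points below and above them. The remaining \<open>m - 2\<close>
  points are free between the two ends, and \<open>g + 1\<close> pairs have \<open>p + q = g\<close>.\<close>

lemma sum_outer_power:
  fixes z :: complex
  assumes m: "m \<ge> 2"
  shows "(\<Sum>A | A \<subseteq> {1..n} \<and> card A = m. z ^ card (outer_points n A))
       = (\<Sum>g<n-1. of_nat ((g + 1) * ((n - 2 - g) choose (m - 2))) * z ^ g)"
proof -
  define \<A> where "\<A> = {A. A \<subseteq> {1..n} \<and> card A = m}"
  \<comment> \<open>At least two points lie from \<open>Min A\<close> to \<open>Max A\<close>, so at most \<open>n - 2\<close> lie outside.\<close>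
  define T where "T = {(p,q). p + q < n - 1}"
  define key where "key A = (Min A - 1, n - Max A)" for A
  have fin: "finite \<A>" by (simp add: \<A>_def)
  have "T \<subseteq> {..<n} \<times> {..<n}" by (auto simp: T_def)
  then have finT: "finite T" using finite_subset by blast
  have key: "key A \<in> T" "card (outer_points n A) = fst (key A) + snd (key A)" "Min A \<ge> 1" "Max A \<le> n"
    if "A \<in> \<A>" for A
  proof -
    have A: "A \<subseteq> {1..n}" "card A = m" using that by (auto simp: \<A>_def)
    have finA: "finite A" and ne: "A \<noteq> {}" using A m finite_subset by auto
    have mem: "Min A \<in> A" "Max A \<in> A" using finA ne by auto
    have "A \<subseteq> {Min A..Max A}" using finA by auto
    have "Min A < Max A"
    proof (rule ccontr)
      assume "\<not> Min A < Max A"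
      then have "A \<subseteq> {Min A}" using \<open>A \<subseteq> {Min A..Max A}\<close> by auto
      then have "card A \<le> 1" using card_mono[of "{Min A}" A] by simp
      then show False using A m by simp
    qed
    moreover show "Min A \<ge> 1" "Max A \<le> n" using mem A by auto
    ultimately show "key A \<in> T" by (auto simp: key_def T_def)
    show "card (outer_points n A) = fst (key A) + snd (key A)"
      using card_outer_points[OF A(1) ne] by (simp add: key_def)
  qed
  have "(\<Sum>A\<in>\<A>. z ^ card (outer_points n A)) = (\<Sum>x\<in>T. \<Sum>A | A \<in> \<A> \<and> key A = x. z ^ card (outer_points n A))"
    using fin finT key(1) by (intro sum.group[symmetric]) auto
  also have "\<dots> = (\<Sum>(p,q)\<in>T. of_nat ((n - 2 - (p + q)) choose (m - 2)) * z ^ (p + q))"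
  proof (intro sum.cong refl, clarify)
    fix p q assume T: "(p, q) \<in> T"
    then have pq: "p + q < n - 1" by (simp add: T_def)
    have set: "{A \<in> \<A>. key A = (p, q)} = {A. A \<subseteq> {1..n} \<and> card A = m \<and> Min A = p + 1 \<and> Max A = n - q}"
    proof (intro equalityI subsetI)
      fix A assume "A \<in> {A \<in> \<A>. key A = (p, q)}"
      then show "A \<in> {A. A \<subseteq> {1..n} \<and> card A = m \<and> Min A = p + 1 \<and> Max A = n - q}"
        using key(3,4)[of A] by (auto simp: key_def \<A>_def)
    qed (use pq in \<open>auto simp: key_def \<A>_def\<close>)
    have "(\<Sum>A | A \<in> \<A> \<and> key A = (p,q). z ^ card (outer_points n A)) = (\<Sum>A | A \<in> \<A> \<and> key A = (p,q). z ^ (p + q))"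
      using key(2) by (intro sum.cong) auto
    also have "\<dots> = of_nat (card {A \<in> \<A>. key A = (p, q)}) * z ^ (p + q)" by simp
    also have "card {A \<in> \<A>. key A = (p, q)} = (n - 2 - (p + q)) choose (m - 2)"
      unfolding set using pq m by (subst card_subsets_Min_Max) (auto intro!: arg_cong2[where f = binomial])
    finally show "(\<Sum>A | A \<in> \<A> \<and> key A = (p,q). z ^ card (outer_points n A))
        = of_nat ((n - 2 - (p + q)) choose (m - 2)) * z ^ (p + q)" .
  qed
  also have "\<dots> = (\<Sum>g<n-1. \<Sum>p\<le>g. of_nat ((n - 2 - g) choose (m - 2)) * z ^ g)"
    unfolding T_def by (subst sum.triangle_reindex) simp
  also have "\<dots> = (\<Sum>g<n-1. of_nat ((g + 1) * ((n - 2 - g) choose (m - 2))) * z ^ g)"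
    by (simp add: algebra_simps)
  finally show ?thesis by (simp add: \<A>_def)
qed

lemma has_integral_beta_nat:
  "((\<lambda>x. x ^ a * (1 - x) ^ b) has_integral (fact a * fact b / fact (a + b + 1))) {0..1::real}"
proof -
  have "((\<lambda>t. t powr (real (a + 1) - 1) * (1 - t) powr (real (b + 1) - 1)) has_integral Beta (real (a + 1)) (real (b + 1))) {0..1}"
    by (rule has_integral_Beta_real) auto
  then have "((\<lambda>x. x ^ a * (1 - x) ^ b) has_integral Beta (real (a + 1)) (real (b + 1))) {0..1::real}"
    \<comment> \<open>At the end points \<open>0 powr 0 = 0\<close> while \<open>0 ^ 0 = 1\<close>.\<close>
    by (rule has_integral_spike_finite[of "{0, 1}", rotated 2]) (auto simp: powr_realpow)
  moreover have "Beta (real (a + 1)) (real (b + 1)) = fact a * fact b / fact (a + b + 1)"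
    using Gamma_fact[of a, where 'a = real] Gamma_fact[of b, where 'a = real] Gamma_fact[of "a + b + 1", where 'a = real]
    by (simp add: Beta_def add_ac)
  ultimately show ?thesis by simp
qed

text \<open>With \<open>k\<close> fixed points, these are the coefficients of \<open>z ^ g\<close> in \<open>mean_outer_power\<close> and in the integral of
  \<open>mean_outer_power_eq_integral\<close>. The last factor on the right is a Beta integral.\<close>

lemma outer_coefficient:
  assumes m: "2 \<le> m" and g: "g \<le> k"
  shows "real ((g + 1) * ((m + k - 2 - g) choose (m - 2))) / real ((m + k) choose m)
     = real m * (real m - 1) * real (k choose g) * (fact (g + 1) * fact (k - g + (m - 2)) / fact (g + 1 + (k - g + (m - 2)) + 1))"
proof -
  obtain j where j: "m = j + 2" using m by (metis add.commute le_Suc_ex)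
  obtain h where h: "k = g + h" using g le_Suc_ex by blast
  define N :: real where "N = fact (j + 2 + (g + h))"
  have N: "N \<noteq> 0" by (simp add: N_def)
  have 1: "real ((h + j) choose j) = fact (h + j) / (fact j * fact h)"
    using binomial_fact[of j "h + j", where 'a = real] by simp
  have 4: "fact (j + 2) = (real j + 2) * (real j + 1) * fact j" by (simp add: algebra_simps)
  have 2: "real ((j + 2 + (g + h)) choose (j + 2)) = N / ((real j + 2) * (real j + 1) * fact j * fact (g + h))"
    unfolding N_def 4[symmetric] using binomial_fact[of "j + 2" "j + 2 + (g + h)", where 'a = real] by simp
  have 3: "real ((g + h) choose g) = fact (g + h) / (fact g * fact h)"
    using binomial_fact[of g "g + h", where 'a = real] by simp
  have 5: "fact (g + 1) = (real g + 1) * fact g" by (simp add: algebra_simps)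
  have nat_eqs: "g + 1 + (h + j) + 1 = j + 2 + (g + h)"
    "j + 2 + (g + h) - 2 - g = h + j" "j + 2 - 2 = j" "g + h - g = h" by auto
  have "(real g + 1) * (fact (h + j) / (fact j * fact h)) / (N / ((real j + 2) * (real j + 1) * fact j * fact (g + h)))
    = (real j + 2) * (real j + 1) * (fact (g + h) / (fact g * fact h)) * ((real g + 1) * fact g * fact (h + j) / N)"
    using N by (simp add: divide_simps)
  then have "real (g + 1) * real ((h + j) choose j) / real ((j + 2 + (g + h)) choose (j + 2))
    = real (j + 2) * (real (j + 2) - 1) * real ((g + h) choose g) * (fact (g + 1) * fact (h + j) / N)"
    unfolding 1 2 3 5 by (simp add: add_ac)
  then show ?thesis
    unfolding j h nat_eqs N_def[symmetric] of_nat_mult .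
qed

text \<open>The number of outer points is binomial with \<open>n - m\<close> trials, given a success probability with the law
  Beta\<open>(2, m - 1)\<close>: the \<open>m\<close>-subset can be thought of as \<open>m\<close> independent uniform points
  in the unit interval, among which the other \<open>n - m\<close> points fall independently, and the first and the last
  gap have together a length of that law. The proof expands the binomial and compares coefficients.\<close>

lemma mean_outer_power_eq_integral:
  fixes z :: complex
  assumes m: "2 \<le> m" "m \<le> n"
  shows "((\<lambda>x. of_real (real m * (real m - 1) * x * (1 - x) ^ (m - 2)) * (1 + of_real x * (z - 1)) ^ (n - m))
     has_integral mean_outer_power n m z) {0..1::real}"
proof -
  define k where "k = n - m"
  have n: "n = m + k" using m by (simp add: k_def)
  define c where "c g = real m * (real m - 1) * real (k choose g)" for g
  have "((\<lambda>x. \<Sum>g\<le>k. of_real (c g * (x ^ (g + 1) * (1 - x) ^ (k - g + (m - 2)))) * z ^ g)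
      has_integral (\<Sum>g\<le>k. of_real (c g * (fact (g + 1) * fact (k - g + (m - 2)) / fact (g + 1 + (k - g + (m - 2)) + 1))) * z ^ g)) {0..1}"
    by (intro has_integral_sum has_integral_mult_left has_integral_of_real has_integral_mult_right has_integral_beta_nat) simp
  moreover have "(\<Sum>g\<le>k. of_real (c g * (x ^ (g + 1) * (1 - x) ^ (k - g + (m - 2)))) * z ^ g)
      = of_real (real m * (real m - 1) * x * (1 - x) ^ (m - 2)) * (1 + of_real x * (z - 1)) ^ k" for x :: real
  proof -
    have "(1 + of_real x * (z - 1)) ^ k = (of_real x * z + of_real (1 - x)) ^ k" by (simp add: algebra_simps)
    also have "\<dots> = (\<Sum>g\<le>k. of_nat (k choose g) * (of_real x * z) ^ g * of_real (1 - x) ^ (k - g))"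
      by (rule binomial_ring)
    finally show ?thesis
      unfolding c_def power_add of_real_mult of_real_power power_mult_distrib sum_distrib_left
      by (simp add: mult_ac sum_distrib_left)
  qed
  moreover have "(\<Sum>g\<le>k. of_real (c g * (fact (g + 1) * fact (k - g + (m - 2)) / fact (g + 1 + (k - g + (m - 2)) + 1))) * z ^ g)
      = mean_outer_power n m z"
  proof -
    have "mean_outer_power n m z = (\<Sum>g<n-1. of_nat ((g + 1) * ((n - 2 - g) choose (m - 2))) * z ^ g) / real (n choose m)"
      unfolding mean_outer_power_def using sum_outer_power[OF m(1)] by simp
    also have "(\<Sum>g<n-1. of_nat ((g + 1) * ((n - 2 - g) choose (m - 2))) * z ^ g)
        = (\<Sum>g\<le>k. of_nat ((g + 1) * ((n - 2 - g) choose (m - 2))) * z ^ g)"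
    proof (intro sum.mono_neutral_right ballI)
      fix i assume i: "i \<in> {..<n - 1} - {..k}"
      then have "n - 2 - i < m - 2" using n by auto
      then have "(n - 2 - i) choose (m - 2) = 0" by (rule binomial_eq_0)
      then show "of_nat ((i + 1) * ((n - 2 - i) choose (m - 2))) * z ^ i = 0"
        by (simp only: mult_0_right of_nat_0 mult_zero_left)
    qed (use m n in auto)
    also have "\<dots> / real (n choose m) = (\<Sum>g\<le>k. of_real (real ((g + 1) * ((n - 2 - g) choose (m - 2))) / real (n choose m)) * z ^ g)"
      by (simp add: sum_divide_distrib)
    also have "\<dots> = (\<Sum>g\<le>k. of_real (c g * (fact (g + 1) * fact (k - g + (m - 2)) / fact (g + 1 + (k - g + (m - 2)) + 1))) * z ^ g)"
      unfolding n c_def using outer_coefficient[OF m(1)] by (intro sum.cong) (simp_all only: atMost_iff)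
    finally show ?thesis by simp
  qed
  ultimately show ?thesis by (simp add: k_def)
qed

section \<open>The Gamma limit\<close>

lemma gamma_2_1_eq_erlang: "gamma_2_1 = density lborel (erlang_density 1 1)"
proof -
  have fin: "finite_measure (density lborel (\<lambda>x. ennreal (erlang_density 0 1 x)))"
    using prob_space_erlang_density[of 1 0] prob_space.finite_measure by simp
  have "gamma_2_1 = density lborel (\<lambda>x. \<integral>\<^sup>+y. ennreal (erlang_density 0 1 (x - y)) * ennreal (erlang_density 0 1 y) \<partial>lborel)"
    unfolding gamma_2_1_def using fin by (intro convolution_density) auto
  also have "(\<lambda>x. \<integral>\<^sup>+y. ennreal (erlang_density 0 1 (x - y)) * ennreal (erlang_density 0 1 y) \<partial>lborel) = erlang_density 1 1"
    using convolution_erlang_density[of 1 0 0] by simp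
  finally show ?thesis .
qed

lemma integrable_erlang_density: "integrable lborel (erlang_density k 1)"
proof -
  interpret prob_space "density lborel (erlang_density k 1)" by (rule prob_space_erlang_density) simp
  have "(\<integral>\<^sup>+x. ennreal (erlang_density k 1 x) \<partial>lborel) = 1"
    using emeasure_space_1 by (simp add: emeasure_density)
  then show ?thesis by (intro integrableI_nn_integral_finite[where x = 1]) auto
qed

lemma char_gamma_2_1:
  "char gamma_2_1 v = (CLINT y|lborel. erlang_density 1 1 y *\<^sub>R iexp (v * y))"
  unfolding char_def gamma_2_1_eq_erlang by (subst integral_density) auto

text \<open>The substitution \<open>x = y / m\<close> puts the parameter on the scale on which the Beta densities converge.\<close>

lemma mean_outer_power_eq_lebesgue:
  fixes z :: complex
  assumes m: "2 \<le> m" "m \<le> n"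
  shows "mean_outer_power n m z = (CLINT y|lborel. indicator {0..real m} y *\<^sub>R
     (of_real ((1 - 1 / real m) * y * (1 - y / real m) ^ (m - 2)) * (1 + of_real (y / real m) * (z - 1)) ^ (n - m)))"
proof -
  define G where "G x = of_real (real m * (real m - 1) * x * (1 - x) ^ (m - 2)) * (1 + of_real x * (z - 1)) ^ (n - m)" for x :: real
  define f where "f x = indicator {0..1} x *\<^sub>R G x" for x :: real
  have G: "(G has_integral mean_outer_power n m z) {0..1}"
    unfolding G_def using mean_outer_power_eq_integral[OF m] by simp
  have "set_integrable lborel {0..1} G"
    unfolding G_def by (intro borel_integrable_atLeastAtMost' continuous_intros)
  then have "(CLINT x:{0..1}|lborel. G x) = mean_outer_power n m z"
    using set_borel_integral_eq_integral(2) integral_unique[OF G] by metis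
  then have "mean_outer_power n m z = (CLINT x|lborel. f x)"
    by (simp add: f_def set_lebesgue_integral_def)
  also have "\<dots> = \<bar>1 / real m\<bar> *\<^sub>R (CLINT y|lborel. f (0 + 1 / real m * y))"
    using m by (intro lborel_integral_real_affine) auto
  also have "\<dots> = (CLINT y|lborel. (1 / real m) *\<^sub>R f (y / real m))" by simp
  also have "\<dots> = (CLINT y|lborel. indicator {0..real m} y *\<^sub>R
     (of_real ((1 - 1 / real m) * y * (1 - y / real m) ^ (m - 2)) * (1 + of_real (y / real m) * (z - 1)) ^ (n - m)))"
  proof (rule Bochner_Integration.integral_cong[OF refl])
    fix y :: real
    have "indicator {0..1} (y / real m) = (indicator {0..real m} y :: real)"
      using m by (auto simp: indicator_def divide_simps)
    moreover have "(1 / real m) *\<^sub>R G (y / real m)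
        = of_real ((1 - 1 / real m) * y * (1 - y / real m) ^ (m - 2)) * (1 + of_real (y / real m) * (z - 1)) ^ (n - m)"
    proof -
      have "(1 / real m) * (real m * (real m - 1) * (y / real m) * (1 - y / real m) ^ (m - 2))
          = (1 - 1 / real m) * y * (1 - y / real m) ^ (m - 2)"
        using m by (simp add: field_simps)
      then show ?thesis unfolding G_def scaleR_conv_of_real of_real_mult[symmetric] mult.assoc[symmetric] by metis
    qed
    ultimately show "(1 / real m) *\<^sub>R f (y / real m) = indicator {0..real m} y *\<^sub>R
     (of_real ((1 - 1 / real m) * y * (1 - y / real m) ^ (m - 2)) * (1 + of_real (y / real m) * (z - 1)) ^ (n - m))"
      unfolding f_def by (metis scaleR_left_commute)
  qed
  finally show ?thesis .
qed

lemma norm_segment_le: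
  fixes z :: complex
  assumes "cmod z \<le> 1" "0 \<le> x" "x \<le> 1"
  shows "cmod (1 + of_real x * (z - 1)) \<le> 1"
proof -
  have "1 + of_real x * (z - 1) = of_real (1 - x) + of_real x * z" by (simp add: algebra_simps)
  also have "cmod \<dots> \<le> cmod (of_real (1 - x)) + cmod (of_real x * z)" by (rule norm_triangle_ineq)
  also have "\<dots> = (1 - x) + x * cmod z" using assms unfolding norm_mult norm_of_real by simp
  also have "\<dots> \<le> 1" using assms mult_left_le[of "cmod z" x] by simp
  finally show ?thesis .
qed

text \<open>For \<open>m \<ge> 2\<close> and \<open>0 \<le> y \<le> m\<close> one has \<open>(1 - y / m)\<^bsup>m - 2\<^esup> \<le> exp (- y + 2 y / m) \<le> exp (2 - y)\<close>.\<close>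

lemma beta_density_dominated:
  assumes "0 \<le> y" "y \<le> real m"
  shows "\<bar>(1 - 1 / real m) * y * (1 - y / real m) ^ (m - 2)\<bar> \<le> exp 2 * erlang_density 1 1 y"
proof (cases "m = 0")
  case False
  have "(1 - y / real m) ^ (m - 2) \<le> exp (2 - y)"
  proof (cases "m \<ge> 2")
    case True
    have "1 - y / real m \<le> exp (- (y / real m))" using exp_ge_add_one_self[of "- (y / real m)"] by simp
    then have "(1 - y / real m) ^ (m - 2) \<le> exp (- (y / real m)) ^ (m - 2)"
      using assms False by (intro power_mono) (auto simp: divide_simps)
    also have "\<dots> = exp (- (real (m - 2) * (y / real m)))" by (simp add: exp_of_nat_mult[symmetric])
    also have "real (m - 2) * (y / real m) = y - 2 * (y / real m)" using True by (simp add: of_nat_diff field_simps)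
    also have "exp (- (y - 2 * (y / real m))) \<le> exp (2 - y)" using assms False by (simp add: divide_simps algebra_simps)
    finally show ?thesis .
  next
    case False
    then show ?thesis using assms \<open>m \<noteq> 0\<close> by (simp add: not_le)
  qed
  moreover have "0 \<le> (1 - y / real m) ^ (m - 2)" using assms False by (intro zero_le_power) (simp add: divide_simps)
  moreover have "0 \<le> 1 - 1 / real m" "1 - 1 / real m \<le> 1" using False by (auto simp: divide_simps)
  ultimately have "\<bar>(1 - 1 / real m) * y * (1 - y / real m) ^ (m - 2)\<bar> \<le> 1 * y * exp (2 - y)"
    using assms unfolding abs_mult by (intro mult_mono) auto
  also have "\<dots> = exp 2 * erlang_density 1 1 y" using assms by (simp add: erlang_density_def exp_diff exp_minus field_simps)
  finally show ?thesis .
qed (use assms in \<open>simp add: erlang_density_def\<close>)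

lemma beta_density_limit:
  assumes m: "filterlim m at_top sequentially"
  shows "(\<lambda>n. (1 - 1 / real (m n)) * y * (1 - y / real (m n)) ^ (m n - 2)) \<longlonglongrightarrow> y * exp (- y)"
proof -
  have minf: "filterlim (\<lambda>n. real (m n)) at_top sequentially"
    using m by (intro filterlim_compose[OF filterlim_real_sequentially])
  have d0: "(\<lambda>n. c / real (m n)) \<longlonglongrightarrow> 0" for c
    by (intro real_tendsto_divide_at_top[OF tendsto_const minf])
  have "(\<lambda>n. (1 + (- y) / real n) ^ n) \<longlonglongrightarrow> exp (- y)" by (rule tendsto_exp_limit_sequentially)
  from filterlim_compose[OF this m] have "(\<lambda>n. (1 - y / real (m n)) ^ m n) \<longlonglongrightarrow> exp (- y)" by simp
  then have "(\<lambda>n. (1 - 1 / real (m n)) * y * ((1 - y / real (m n)) ^ m n / (1 - y / real (m n))\<^sup>2)) \<longlonglongrightarrow> (1 - 0) * y * (exp (- y) / (1 - 0)\<^sup>2)"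
    by (intro tendsto_intros d0) auto
  moreover have "eventually (\<lambda>n. (1 - 1 / real (m n)) * y * ((1 - y / real (m n)) ^ m n / (1 - y / real (m n))\<^sup>2)
      = (1 - 1 / real (m n)) * y * (1 - y / real (m n)) ^ (m n - 2)) sequentially"
  proof -
    have "eventually (\<lambda>n. m n \<ge> 2) sequentially" using m by (simp add: filterlim_at_top)
    moreover have "eventually (\<lambda>n. real (m n) > \<bar>y\<bar>) sequentially" using minf by (simp add: filterlim_at_top_dense)
    ultimately show ?thesis
    proof eventually_elim
      case (elim n)
      then have "1 - y / real (m n) \<noteq> 0" by auto
      then show ?case using elim by (simp add: power_diff)
    qed
  qed
  ultimately show ?thesis by (auto intro: Lim_transform_eventually)
qed

lemma scaled_iexp_minus_one_limit:
  assumes s: "filterlim s at_top sequentially"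
  shows "(\<lambda>n. complex_of_real (s n) * (iexp (u / s n) - 1)) \<longlonglongrightarrow> \<i> * of_real u"
proof -
  have "(\<lambda>n. complex_of_real (s n) * (iexp (u / s n) - 1) - \<i> * of_real u) \<longlonglongrightarrow> 0"
  proof (rule Lim_null_comparison)
    show "(\<lambda>n. u\<^sup>2 / s n) \<longlonglongrightarrow> 0" by (intro real_tendsto_divide_at_top[OF tendsto_const s])
    have "eventually (\<lambda>n. s n > 0) sequentially" using s by (simp add: filterlim_at_top_dense)
    then show "\<forall>\<^sub>F n in sequentially. cmod (complex_of_real (s n) * (iexp (u / s n) - 1) - \<i> * of_real u) \<le> u\<^sup>2 / s n"
    proof eventually_elim
      case (elim n)
      have "complex_of_real (s n) * (iexp (u / s n) - 1) - \<i> * of_real u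
          = complex_of_real (s n) * (iexp (u / s n) - (1 + \<i> * of_real (u / s n)))"
        using elim by (simp add: field_simps)
      also have "cmod \<dots> \<le> s n * (\<bar>u / s n\<bar>\<^sup>2 / 2)"
        using iexp_approx1[of "u / s n" 1] elim unfolding norm_mult
        by (intro mult_mono) (auto simp: eval_nat_numeral)
      also have "\<dots> \<le> u\<^sup>2 / s n" using elim by (simp add: power2_eq_square field_simps)
      finally show ?case .
    qed
  qed
  then show ?thesis by (simp add: LIM_zero_iff)
qed

text \<open>Dominated convergence: the Beta densities tend to the density \<open>y exp (- y)\<close> of Gamma\<open>(2, 1)\<close>, and the
  characteristic function of the binomial law with \<open>n - m\<close> trials of parameter \<open>y / m\<close>, scaled by \<open>s\<close>, tends to
  that of the constant \<open>g y\<close>. This covers bounded \<open>(n - m) / m\<close> as well, with \<open>g = 0\<close>.\<close>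

lemma mean_outer_power_limit:
  fixes m :: "nat \<Rightarrow> nat" and s :: "nat \<Rightarrow> real"
  assumes m: "filterlim m at_top sequentially" and mn: "\<And>n. m n \<le> n"
    and s: "filterlim s at_top sequentially"
    and g: "(\<lambda>n. real (n - m n) / real (m n) / s n) \<longlonglongrightarrow> g"
  shows "(\<lambda>n. mean_outer_power n (m n) (iexp (u / s n))) \<longlonglongrightarrow> char gamma_2_1 (g * u)"
proof -
  define b where "b n y = complex_of_real (y / real (m n)) * (iexp (u / s n) - 1)" for n y
  define F where "F n y = indicator {0..real (m n)} y *\<^sub>R
     (of_real ((1 - 1 / real (m n)) * y * (1 - y / real (m n)) ^ (m n - 2)) * (1 + b n y) ^ (n - m n))" for n y
  have m2: "eventually (\<lambda>n. m n \<ge> 2) sequentially" using m by (simp add: filterlim_at_top)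
  have minf: "filterlim (\<lambda>n. real (m n)) at_top sequentially"
    using m by (intro filterlim_compose[OF filterlim_real_sequentially])
  have z1: "(\<lambda>n. iexp (u / s n) - 1) \<longlonglongrightarrow> 0"
    by (rule Lim_null_comparison[OF _ tendsto_rabs_zero[OF real_tendsto_divide_at_top[OF tendsto_const[of u] s]]])
      (intro always_eventually allI norm_iexp_minus_one_le)
  have pw: "(\<lambda>n. (1 + b n y) ^ (n - m n)) \<longlonglongrightarrow> iexp (g * u * y)" if y: "y \<ge> 0" for y
  proof -
    define c where "c n = complex_of_real (real (n - m n)) * b n y" for n
    have b0: "(\<lambda>n. b n y) \<longlonglongrightarrow> 0"
    proof -
      have "(\<lambda>n. complex_of_real (y / real (m n))) \<longlonglongrightarrow> of_real 0"
        by (intro tendsto_of_real real_tendsto_divide_at_top[OF tendsto_const minf])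
      from tendsto_mult[OF this z1] show ?thesis by (simp add: b_def)
    qed
    have c: "c \<longlonglongrightarrow> \<i> * of_real (g * u * y)"
    proof -
      have "(\<lambda>n. complex_of_real y * (complex_of_real (real (n - m n) / real (m n) / s n) * (complex_of_real (s n) * (iexp (u / s n) - 1))))
         \<longlonglongrightarrow> complex_of_real y * (complex_of_real g * (\<i> * of_real u))"
        by (intro tendsto_intros scaled_iexp_minus_one_limit s g)
      moreover have "eventually (\<lambda>n. complex_of_real y * (complex_of_real (real (n - m n) / real (m n) / s n) * (complex_of_real (s n) * (iexp (u / s n) - 1))) = c n) sequentially"
      proof -
        have "eventually (\<lambda>n. s n > 0) sequentially" using s by (simp add: filterlim_at_top_dense)
        then show ?thesis
        proof eventually_elim
          case (elim n)
          have "of_real y * (of_real (a / k / s n) * (of_real (s n) * w)) = of_real a * (of_real (y / k) * w)"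
            for a k :: real and w :: complex
            using elim by (simp add: field_simps)
          then show ?case unfolding c_def b_def .
        qed
      qed
      ultimately have "c \<longlonglongrightarrow> complex_of_real y * (complex_of_real g * (\<i> * of_real u))"
        by (rule Lim_transform_eventually)
      then show ?thesis by (simp add: mult_ac)
    qed
    \<comment> \<open>\<open>N\<close> factors \<open>1 + b\<close> differ from \<open>exp (N b)\<close> by \<open>O(N \<bar>b\<bar>\<^sup>2) = O(\<bar>c\<bar> \<bar>b\<bar>)\<close>, where \<open>b\<close> tends to \<open>0\<close>.\<close>
    have diff: "(\<lambda>n. (1 + b n y) ^ (n - m n) - exp (c n)) \<longlonglongrightarrow> 0"
    proof (rule Lim_null_comparison)
      show "(\<lambda>n. exp 2 * cmod (c n) * cmod (b n y)) \<longlonglongrightarrow> 0"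
        using tendsto_mult[OF tendsto_mult[OF tendsto_const tendsto_norm[OF c]] tendsto_norm[OF b0]] by simp
      have ev: "eventually (\<lambda>n. cmod (b n y) < 2) sequentially"
        using order_tendstoD(2)[OF tendsto_norm[OF b0], of 2] by simp
      have ev2: "eventually (\<lambda>n. real (m n) > y) sequentially" using minf by (simp add: filterlim_at_top_dense)
      show "\<forall>\<^sub>F n in sequentially. cmod ((1 + b n y) ^ (n - m n) - exp (c n)) \<le> exp 2 * cmod (c n) * cmod (b n y)"
        using ev ev2
      proof eventually_elim
        case (elim n)
        have 1: "cmod (1 + b n y) \<le> 1"
          unfolding b_def using elim y by (intro norm_segment_le) auto
        have "Re (iexp (u / s n) - 1) \<le> 0" using complex_Re_le_cmod[of "iexp (u / s n)"] by simp
        then have "Re (b n y) \<le> 0"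
          unfolding b_def using y by (simp add: mult_nonneg_nonpos divide_nonpos_nonneg)
        then have 2: "cmod (exp (b n y)) \<le> 1" by (rule norm_exp_le_one)
        have "exp (c n) = exp (b n y) ^ (n - m n)" unfolding c_def by (simp add: exp_of_nat_mult)
        then have "cmod ((1 + b n y) ^ (n - m n) - exp (c n)) \<le> real (n - m n) * cmod (1 + b n y - exp (b n y))"
          using norm_power_diff[OF 1 2] by simp
        also have "\<dots> \<le> real (n - m n) * (exp 2 * (cmod (b n y))\<^sup>2)"
          using elim by (intro mult_left_mono norm_exp_minus_linear_le) auto
        also have "\<dots> = exp 2 * cmod (c n) * cmod (b n y)"
          unfolding c_def norm_mult norm_of_real by (simp add: power2_eq_square)
        finally show ?case .
      qed
    qed
    have "(\<lambda>n. exp (c n)) \<longlonglongrightarrow> iexp (g * u * y)" using c by (rule tendsto_exp)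
    from tendsto_add[OF diff this] show ?thesis by simp
  qed
  have lim: "(\<lambda>n. F n y) \<longlonglongrightarrow> erlang_density 1 1 y *\<^sub>R iexp (g * u * y)" for y
  proof (cases "y \<ge> 0")
    case True
    have "(\<lambda>n. complex_of_real ((1 - 1 / real (m n)) * y * (1 - y / real (m n)) ^ (m n - 2)) * (1 + b n y) ^ (n - m n))
        \<longlonglongrightarrow> complex_of_real (y * exp (- y)) * iexp (g * u * y)"
      by (intro tendsto_mult tendsto_of_real beta_density_limit m pw True)
    moreover have "eventually (\<lambda>n. complex_of_real ((1 - 1 / real (m n)) * y * (1 - y / real (m n)) ^ (m n - 2)) * (1 + b n y) ^ (n - m n) = F n y) sequentially"
    proof -
      have "eventually (\<lambda>n. real (m n) > y) sequentially" using minf by (simp add: filterlim_at_top_dense)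
      then show ?thesis by eventually_elim (use True in \<open>simp add: F_def\<close>)
    qed
    ultimately have "(\<lambda>n. F n y) \<longlonglongrightarrow> complex_of_real (y * exp (- y)) * iexp (g * u * y)"
      by (rule Lim_transform_eventually)
    then show ?thesis using True by (simp add: erlang_density_def scaleR_conv_of_real)
  qed (simp add: F_def erlang_density_def)
  have meas: "F n \<in> borel_measurable lborel" for n
    unfolding F_def b_def by measurable
  have dom: "cmod (F n y) \<le> exp 2 * erlang_density 1 1 y" for n y
  proof (cases "y \<in> {0..real (m n)}")
    case True
    have "cmod (1 + b n y) \<le> 1"
      unfolding b_def using True by (intro norm_segment_le) (auto simp: divide_le_eq_1)
    then have "cmod ((1 + b n y) ^ (n - m n)) \<le> 1" by (simp add: norm_power power_le_one)
    moreover have "\<bar>(1 - 1 / real (m n)) * y * (1 - y / real (m n)) ^ (m n - 2)\<bar> \<le> exp 2 * erlang_density 1 1 y"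
      using True by (intro beta_density_dominated) auto
    ultimately have "\<bar>(1 - 1 / real (m n)) * y * (1 - y / real (m n)) ^ (m n - 2)\<bar> * cmod ((1 + b n y) ^ (n - m n))
        \<le> exp 2 * erlang_density 1 1 y * 1"
      by (intro mult_mono) auto
    then show ?thesis using True unfolding F_def norm_scaleR norm_mult norm_of_real by simp
  qed (simp add: F_def)
  have "(\<lambda>n. CLINT y|lborel. F n y) \<longlonglongrightarrow> (CLINT y|lborel. erlang_density 1 1 y *\<^sub>R iexp (g * u * y))"
  proof (rule integral_dominated_convergence[where w = "\<lambda>y. exp 2 * erlang_density 1 1 y"])
    show "integrable lborel (\<lambda>y. exp 2 * erlang_density 1 1 y)"
      by (intro integrable_mult_right integrable_erlang_density)
    show "(\<lambda>y. erlang_density 1 1 y *\<^sub>R iexp (g * u * y)) \<in> borel_measurable lborel" by measurable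
  qed (use lim dom meas in auto)
  moreover have "eventually (\<lambda>n. (CLINT y|lborel. F n y) = mean_outer_power n (m n) (iexp (u / s n))) sequentially"
    using m2 by eventually_elim (simp add: F_def b_def mean_outer_power_eq_lebesgue mn)
  ultimately show ?thesis
    unfolding char_gamma_2_1 by (rule Lim_transform_eventually)
qed

section \<open>Convergence in distribution\<close>

lemma char_cyclic_law:
  assumes "cycle_type n t"
  shows "char (cyclic_law n t (\<lambda>\<tau>. (real (high_records n \<tau>) - c) / s)) u
    = (\<Sum>\<tau>\<in>cyclic_perms n t. iexp (u / s) ^ high_records n \<tau>) / real (card (cyclic_perms n t)) * iexp (- (u / s * c))"
proof -
  define C where "C = cyclic_perms n t"
  have C: "finite C" "C \<noteq> {}"
    unfolding C_def using finite_cyclic_perms cyclic_perms_nonempty[OF assms] by auto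
  have "char (cyclic_law n t (\<lambda>\<tau>. (real (high_records n \<tau>) - c) / s)) u
      = (CLINT \<tau>|measure_pmf (pmf_of_set C). iexp (u * ((real (high_records n \<tau>) - c) / s)))"
    unfolding char_def cyclic_law_def C_def by (subst integral_distr) auto
  also have "\<dots> = (\<Sum>\<tau>\<in>C. pmf (pmf_of_set C) \<tau> *\<^sub>R iexp (u * ((real (high_records n \<tau>) - c) / s)))"
    using C by (intro integral_measure_pmf) auto
  also have "\<dots> = (\<Sum>\<tau>\<in>C. iexp (u / s) ^ high_records n \<tau> * (iexp (- (u / s * c)) / real (card C)))"
  proof (intro sum.cong refl)
    fix \<tau> assume \<tau>: "\<tau> \<in> C"
    define k where "k = high_records n \<tau>"
    have "\<i> * complex_of_real (u * ((real k - c) / s))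
        = of_nat k * (\<i> * complex_of_real (u / s)) + \<i> * complex_of_real (- (u / s * c))"
      by (simp add: diff_divide_distrib algebra_simps)
    then have "iexp (u * ((real k - c) / s)) = iexp (u / s) ^ k * iexp (- (u / s * c))"
      by (simp only: exp_add exp_of_nat_mult)
    then show "pmf (pmf_of_set C) \<tau> *\<^sub>R iexp (u * ((real k - c) / s)) = iexp (u / s) ^ k * (iexp (- (u / s * c)) / real (card C))"
      using C \<tau> by (simp add: scaleR_conv_of_real)
  qed
  also have "\<dots> = (\<Sum>\<tau>\<in>C. iexp (u / s) ^ high_records n \<tau>) * (iexp (- (u / s * c)) / real (card C))"
    by (rule sum_distrib_right[symmetric])
  finally show ?thesis by (simp add: C_def)
qed

text \<open>The scale \<open>s\<close> and the centring \<open>c\<close> are left open, so that both normalisations of the theorem are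
  instances.\<close>

lemma char_cyclic_law_limit:
  fixes t :: "nat \<Rightarrow> nat \<Rightarrow> nat" and s c :: "nat \<Rightarrow> real"
  assumes t: "\<And>n. cycle_type n (t n)"
  defines "m \<equiv> \<lambda>n. nonfixed n (t n)"
  assumes m: "filterlim m at_top sequentially" and s: "filterlim s at_top sequentially"
    and w: "(\<lambda>n. sqrt (ln (m n)) / s n) \<longlonglongrightarrow> w"
    and g: "(\<lambda>n. real (n - m n) / real (m n) / s n) \<longlonglongrightarrow> g"
    and c: "(\<lambda>n. (c n - ln (m n)) / s n) \<longlonglongrightarrow> 0"
  shows "(\<lambda>n. char (cyclic_law n (t n) (\<lambda>\<tau>. (real (high_records n \<tau>) - c n) / s n)) u)
    \<longlonglongrightarrow> complex_of_real (exp (- ((w * u)\<^sup>2 / 2))) * char gamma_2_1 (g * u)"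
proof -
  define z where "z n = iexp (u / s n)" for n
  define X where "X n = (\<Sum>\<tau>\<in>cyclic_perms n (t n). z n ^ high_records n \<tau>) / real (card (cyclic_perms n (t n)))" for n
  define P where "P n = (\<Prod>i=1..m n. 1 + (z n - 1) / real i)" for n
  define G where "G n = mean_outer_power n (m n) (z n)" for n
  have mn: "m n \<le> n" for n by (simp add: m_def nonfixed_def)
  have minf: "filterlim (\<lambda>n. real (m n)) at_top sequentially"
    using m by (intro filterlim_compose[OF filterlim_real_sequentially])
  have XPG: "(\<lambda>n. (X n - P n * G n) * iexp (- (u / s n * c n))) \<longlonglongrightarrow> 0"
  proof (rule Lim_null_comparison)
    show "(\<lambda>n. 66 / real (m n)) \<longlonglongrightarrow> 0" by (intro real_tendsto_divide_at_top[OF tendsto_const minf])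
    have "eventually (\<lambda>n. m n \<ge> 1) sequentially" using m by (simp add: filterlim_at_top)
    then show "\<forall>\<^sub>F n in sequentially. cmod ((X n - P n * G n) * iexp (- (u / s n * c n))) \<le> 66 / real (m n)"
    proof eventually_elim
      case (elim n)
      define K where "K = real (card (cyclic_perms n (t n)))"
      define S where "S = (\<Sum>\<tau>\<in>cyclic_perms n (t n). z n ^ high_records n \<tau>)"
      have K: "K > 0"
        unfolding K_def using finite_cyclic_perms cyclic_perms_nonempty[OF t] by (simp add: card_gt_0_iff)
      have n1: "n \<ge> 1" using elim mn[of n] by simp
      have "cmod (S - K * (P n * G n)) \<le> 66 / real (m n) * K"
        using sum_high_records_close[OF n1, of "z n" "t n"] elim
        unfolding K_def P_def G_def m_def S_def by (simp add: z_def)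
      moreover have "X n - P n * G n = (S - K * (P n * G n)) / K"
        unfolding X_def K_def[symmetric] S_def[symmetric] using K by (simp add: field_simps)
      ultimately have "cmod (X n - P n * G n) \<le> 66 / real (m n)"
        using K by (simp add: norm_divide divide_le_eq)
      then show ?case by (simp only: norm_mult norm_exp_i_times mult_1_right)
    qed
  qed
  have G: "G \<longlonglongrightarrow> char gamma_2_1 (g * u)"
    unfolding G_def[abs_def] z_def using mean_outer_power_limit[OF m mn s g] .
  have P: "(\<lambda>n. P n * iexp (- (u / s n * ln (m n)))) \<longlonglongrightarrow> complex_of_real (exp (- ((w * u)\<^sup>2 / 2)))"
    unfolding P_def z_def by (rule bernoulli_product_limit[OF m s w])
  have "(\<lambda>n. - (u * ((c n - ln (m n)) / s n))) \<longlonglongrightarrow> - (u * 0)" by (intro tendsto_intros c)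
  then have "(\<lambda>n. iexp (- (u * ((c n - ln (m n)) / s n)))) \<longlonglongrightarrow> iexp (- (u * 0))"
    by (intro tendsto_exp tendsto_mult tendsto_const tendsto_of_real)
  from tendsto_mult[OF tendsto_mult[OF P G] this]
  have "(\<lambda>n. P n * iexp (- (u / s n * ln (m n))) * G n * iexp (- (u * ((c n - ln (m n)) / s n))))
      \<longlonglongrightarrow> complex_of_real (exp (- ((w * u)\<^sup>2 / 2))) * char gamma_2_1 (g * u)" by simp
  moreover have "P n * iexp (- (u / s n * ln (m n))) * G n * iexp (- (u * ((c n - ln (m n)) / s n)))
      = P n * G n * iexp (- (u / s n * c n))" for n
  proof -
    have "iexp (- (u / s n * ln (m n))) * iexp (- (u * ((c n - ln (m n)) / s n))) = iexp (- (u / s n * c n))"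
      unfolding exp_add[symmetric] distrib_left[symmetric] of_real_add[symmetric]
      by (simp add: diff_divide_distrib algebra_simps)
    then show ?thesis by (metis mult.assoc mult.commute)
  qed
  ultimately have "(\<lambda>n. P n * G n * iexp (- (u / s n * c n)))
      \<longlonglongrightarrow> complex_of_real (exp (- ((w * u)\<^sup>2 / 2))) * char gamma_2_1 (g * u)" by (simp only:)
  from tendsto_add[OF XPG this]
  have "(\<lambda>n. X n * iexp (- (u / s n * c n))) \<longlonglongrightarrow> complex_of_real (exp (- ((w * u)\<^sup>2 / 2))) * char gamma_2_1 (g * u)"
    by (simp add: algebra_simps)
  then show ?thesis unfolding char_cyclic_law[OF t] X_def z_def .
qed

lemma real_distribution_cyclic_law: "real_distribution (cyclic_law n t f)"
  unfolding cyclic_law_def by (rule prob_space.real_distribution_distr[OF prob_space_measure_pmf]) simp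

lemma real_distribution_gamma_2_1: "real_distribution gamma_2_1"
  unfolding real_distribution_def real_distribution_axioms_def gamma_2_1_eq_erlang
  by (simp add: prob_space_erlang_density)

lemma sqrt_ln_at_top_compose:
  assumes "filterlim m at_top sequentially"
  shows "filterlim (\<lambda>n. sqrt (ln (real (m n)))) at_top sequentially"
proof -
  have "filterlim (\<lambda>k. sqrt (ln (real k))) at_top sequentially" by real_asymp
  then show ?thesis using assms by (rule filterlim_compose)
qed

context
  fixes m :: "nat \<Rightarrow> nat" and x :: "nat \<Rightarrow> real"
  assumes mn: "\<And>n. m n \<le> n" and m: "filterlim m at_top sequentially"
  defines "x \<equiv> \<lambda>n. real (m n) / (real n / sqrt (ln (real n)))"
begin

text \<open>From \<open>m \<ge> c n / sqrt (ln n)\<close> one gets \<open>ln n - ln m \<le> ln (ln n) / 2 - ln c\<close>.\<close>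

lemma ln_nonfixed_close:
  assumes c: "c > 0" "eventually (\<lambda>n. x n \<ge> c) sequentially"
  shows "(\<lambda>n. (ln (real n) - ln (real (m n))) / sqrt (ln (real n))) \<longlonglongrightarrow> 0"
proof (rule real_tendsto_sandwich)
  have ev: "eventually (\<lambda>n. n \<ge> 3 \<and> m n \<ge> 1 \<and> x n \<ge> c) sequentially"
    using m[unfolded filterlim_at_top, rule_format, of 1] c(2) eventually_ge_at_top[of 3]
    by eventually_elim auto
  show "\<forall>\<^sub>F n in sequentially. 0 \<le> (ln (real n) - ln (real (m n))) / sqrt (ln (real n))"
    using ev by eventually_elim (use mn in auto)
  show "\<forall>\<^sub>F n in sequentially. (ln (real n) - ln (real (m n))) / sqrt (ln (real n))
      \<le> (ln (ln (real n)) / 2 - ln c) / sqrt (ln (real n))"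
    using ev
  proof eventually_elim
    case (elim n)
    have ln: "ln (real n) > 0" using elim by simp
    have "c * (real n / sqrt (ln (real n))) \<le> real (m n)"
    proof -
      have "real n > 0" using elim by simp
      moreover have "c \<le> real (m n) * sqrt (ln (real n)) / real n" using elim by (simp add: x_def)
      ultimately have "c * real n \<le> real (m n) * sqrt (ln (real n))" by (simp only: pos_le_divide_eq)
      then show ?thesis using ln by (simp add: divide_le_eq)
    qed
    then have "ln (c * (real n / sqrt (ln (real n)))) \<le> ln (real (m n))"
      using elim ln c by (intro ln_mono) auto
    moreover have "ln (c * (real n / sqrt (ln (real n)))) = ln c + ln (real n) - ln (ln (real n)) / 2"
      using elim ln c by (simp add: ln_mult ln_div ln_sqrt)
    ultimately have "ln (real n) - ln (real (m n)) \<le> ln (ln (real n)) / 2 - ln c" by simp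
    then show ?case using ln by (intro divide_right_mono) auto
  qed
  show "(\<lambda>n. (ln (ln (real n)) / 2 - ln c) / sqrt (ln (real n))) \<longlonglongrightarrow> 0" by real_asymp
qed simp

lemma sqrt_ln_nonfixed_ratio:
  assumes c: "c > 0" "eventually (\<lambda>n. x n \<ge> c) sequentially"
  shows "(\<lambda>n. sqrt (ln (real (m n))) / sqrt (ln (real n))) \<longlonglongrightarrow> 1"
proof -
  have "(\<lambda>n. 1 / sqrt (ln (real n))) \<longlonglongrightarrow> 0" by real_asymp
  from tendsto_mult[OF ln_nonfixed_close[OF c] this]
  have "(\<lambda>n. sqrt (1 - (ln (real n) - ln (real (m n))) / sqrt (ln (real n)) * (1 / sqrt (ln (real n))))) \<longlonglongrightarrow> sqrt (1 - 0 * 0)"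
    by (intro tendsto_real_sqrt tendsto_diff tendsto_const)
  moreover have "eventually (\<lambda>n. sqrt (1 - (ln (real n) - ln (real (m n))) / sqrt (ln (real n)) * (1 / sqrt (ln (real n))))
      = sqrt (ln (real (m n))) / sqrt (ln (real n))) sequentially"
    using eventually_ge_at_top[of 3]
  proof eventually_elim
    case (elim n)
    then have ln: "ln (real n) > 0" by simp
    then have "1 - (ln (real n) - ln (real (m n))) / sqrt (ln (real n)) * (1 / sqrt (ln (real n))) = ln (real (m n)) / ln (real n)"
      by (simp add: field_simps)
    then show ?case by (simp add: real_sqrt_divide)
  qed
  ultimately show ?thesis using Lim_transform_eventually by fastforce
qed

text \<open>For \<open>\<alpha> = 0\<close> the quotient is eventually at most \<open>x\<close>. Otherwise it is \<open>1 / (1 + q / L)\<close> with \<open>q = (n - m) / m\<close> and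
  \<open>L = sqrt (ln m)\<close>, and \<open>q / L\<close> is asymptotic to \<open>n / (m L)\<close>, hence to \<open>1 / x\<close>, because \<open>ln m\<close> is asymptotic to \<open>ln n\<close>.\<close>

lemma normal_weight_limit:
  assumes \<alpha>: "0 \<le> \<alpha>" "(\<lambda>n. ereal (x n)) \<longlonglongrightarrow> \<alpha>"
  shows "(\<lambda>n. sqrt (ln (real (m n))) / (real (n - m n) / real (m n) + sqrt (ln (real (m n))))) \<longlonglongrightarrow> weight_normal \<alpha>"
proof (cases "\<alpha> = 0")
  case True
  then have x0: "x \<longlonglongrightarrow> 0" using \<alpha>(2) by (simp add: zero_ereal_def)
  have ev: "eventually (\<lambda>n. sqrt (ln (real (m n))) \<ge> 1 \<and> m n \<ge> 1) sequentially"
    using sqrt_ln_at_top_compose[OF m, unfolded filterlim_at_top, rule_format, of 1]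
      m[unfolded filterlim_at_top, rule_format, of 1]
    by eventually_elim auto
  have "(\<lambda>n. sqrt (ln (real (m n))) / (real (n - m n) / real (m n) + sqrt (ln (real (m n))))) \<longlonglongrightarrow> 0"
  proof (rule real_tendsto_sandwich[OF _ _ tendsto_const x0])
    show "\<forall>\<^sub>F n in sequentially. 0 \<le> sqrt (ln (real (m n))) / (real (n - m n) / real (m n) + sqrt (ln (real (m n))))"
      using ev by eventually_elim auto
    show "\<forall>\<^sub>F n in sequentially. sqrt (ln (real (m n))) / (real (n - m n) / real (m n) + sqrt (ln (real (m n)))) \<le> x n"
      using ev
    proof eventually_elim
      case (elim n)
      have "real n / real (m n) = real (n - m n) / real (m n) + 1"
        using elim mn[of n] by (simp add: of_nat_diff field_simps)
      then have "real n / real (m n) \<le> real (n - m n) / real (m n) + sqrt (ln (real (m n)))" using elim by simp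
      moreover have "sqrt (ln (real (m n))) \<le> sqrt (ln (real n))" using elim mn[of n] by simp
      moreover have "real n / real (m n) > 0" using elim mn[of n] by simp
      ultimately have "sqrt (ln (real (m n))) / (real (n - m n) / real (m n) + sqrt (ln (real (m n))))
          \<le> sqrt (ln (real n)) / (real n / real (m n))" using elim by (intro frac_le) auto
      then show ?case by (simp add: x_def mult.commute)
    qed
  qed
  then show ?thesis using True by (simp add: weight_normal_def)
next
  case False
  \<comment> \<open>The limit of \<open>1 / x\<close>, and hence of \<open>q / L\<close>.\<close>
  define \<beta> where "\<beta> = (if \<alpha> = \<infinity> then 0 else 1 / real_of_ereal \<alpha>)"
  obtain c where c: "c > 0" "eventually (\<lambda>n. x n \<ge> c) sequentially" and inv: "(\<lambda>n. 1 / x n) \<longlonglongrightarrow> \<beta>"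
  proof (cases "\<alpha> = \<infinity>")
    case True
    then have "filterlim x at_top sequentially" using \<alpha>(2) by (simp add: tendsto_PInfty_eq_at_top)
    then have "eventually (\<lambda>n. x n \<ge> 1) sequentially" "(\<lambda>n. 1 / x n) \<longlonglongrightarrow> 0"
      by (simp_all add: filterlim_at_top real_tendsto_divide_at_top[OF tendsto_const])
    then show thesis using that[of 1] True by (simp add: \<beta>_def)
  next
    case fin: False
    then obtain a where a: "\<alpha> = ereal a" using \<alpha>(1) by (cases \<alpha>) auto
    then have a0: "a > 0" using \<alpha>(1) False by (simp add: zero_ereal_def order_less_le)
    have xa: "x \<longlonglongrightarrow> a" using \<alpha>(2) a by simp
    have "eventually (\<lambda>n. x n > a / 2) sequentially" using order_tendstoD(1)[OF xa, of "a / 2"] a0 by simp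
    then have "eventually (\<lambda>n. x n \<ge> a / 2) sequentially" by eventually_elim simp
    moreover have "(\<lambda>n. 1 / x n) \<longlonglongrightarrow> 1 / a" using xa a0 by (intro tendsto_intros) auto
    ultimately show thesis using that[of "a / 2"] a a0 by (simp add: \<beta>_def)
  qed
  have "(\<lambda>n. 1 / x n * (1 / (sqrt (ln (real (m n))) / sqrt (ln (real n)))) - 1 / sqrt (ln (real (m n)))) \<longlonglongrightarrow> \<beta> * (1 / 1) - 0"
    by (intro tendsto_intros inv sqrt_ln_nonfixed_ratio[OF c]
        real_tendsto_divide_at_top[OF tendsto_const sqrt_ln_at_top_compose[OF m]]) auto
  moreover have \<beta>0: "\<beta> \<ge> 0" using \<alpha>(1) by (simp add: \<beta>_def real_of_ereal_pos)
  ultimately have lim: "(\<lambda>n. 1 / (1 + (1 / x n * (1 / (sqrt (ln (real (m n))) / sqrt (ln (real n)))) - 1 / sqrt (ln (real (m n)))))) \<longlonglongrightarrow> 1 / (1 + (\<beta> * (1/1) - 0))"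
    by (intro tendsto_divide tendsto_add tendsto_const) auto
  have "eventually (\<lambda>n. sqrt (ln (real (m n))) \<ge> 1 \<and> m n \<ge> 1 \<and> n \<ge> 3) sequentially"
    using sqrt_ln_at_top_compose[OF m, unfolded filterlim_at_top, rule_format, of 1]
      m[unfolded filterlim_at_top, rule_format, of 1] eventually_ge_at_top[of 3]
    by eventually_elim auto
  then have ev: "eventually (\<lambda>n. 1 / (1 + (1 / x n * (1 / (sqrt (ln (real (m n))) / sqrt (ln (real n)))) - 1 / sqrt (ln (real (m n)))))
      = sqrt (ln (real (m n))) / (real (n - m n) / real (m n) + sqrt (ln (real (m n))))) sequentially"
  proof eventually_elim
    case (elim n)
    define L where "L = sqrt (ln (real (m n)))"
    define N where "N = sqrt (ln (real n))"
    define q where "q = real (n - m n) / real (m n)"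
    have L: "L \<ge> 1" using elim by (simp add: L_def)
    have N: "N > 0" using elim by (simp add: N_def)
    have q: "real n / real (m n) = q + 1" "q \<ge> 0"
      using elim mn[of n] by (auto simp: q_def of_nat_diff field_simps)
    have "1 / x n = (q + 1) / N" unfolding x_def N_def[symmetric] q(1)[symmetric] by simp
    then have "1 / x n * (1 / (L / N)) - 1 / L = q / L" using N L by (simp add: field_simps)
    then have "1 / (1 + (1 / x n * (1 / (L / N)) - 1 / L)) = 1 / (1 + q / L)" by simp
    also have "\<dots> = L / (q + L)" using L q by (simp add: field_simps)
    finally show ?case unfolding L_def N_def q_def .
  qed
  have "1 / (1 + (\<beta> * (1/1) - 0)) = weight_normal \<alpha>"
  proof (cases "\<alpha> = \<infinity>")
    case fin: False
    then obtain a where a: "\<alpha> = ereal a" using \<alpha>(1) by (cases \<alpha>) auto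
    then have "a > 0" using \<alpha>(1) False by (simp add: zero_ereal_def order_less_le)
    then show ?thesis using a by (simp add: \<beta>_def weight_normal_def field_simps)
  qed (simp add: \<beta>_def weight_normal_def)
  then show ?thesis using Lim_transform_eventually[OF lim ev] by simp
qed

end

lemma char_distr_scale:
  fixes Y :: "'a \<Rightarrow> real"
  assumes [measurable]: "Y \<in> borel_measurable M"
  shows "char (distr M borel (\<lambda>\<omega>. a * Y \<omega>)) u = char (distr M borel Y) (a * u)"
  unfolding char_def by (simp add: integral_distr mult_ac)

lemma char_normal_gamma_combination:
  fixes Y \<Gamma>\<^sub>2 :: "'a \<Rightarrow> real"
  assumes "prob_space \<Omega>" and indep: "prob_space.indep_var \<Omega> borel Y borel \<Gamma>\<^sub>2"
    and Y: "distr \<Omega> borel Y = std_normal_distribution" and \<Gamma>: "distr \<Omega> borel \<Gamma>\<^sub>2 = gamma_2_1"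
  shows "real_distribution (distr \<Omega> borel (\<lambda>\<omega>. a * Y \<omega> + b * \<Gamma>\<^sub>2 \<omega>))"
    and "char (distr \<Omega> borel (\<lambda>\<omega>. a * Y \<omega> + b * \<Gamma>\<^sub>2 \<omega>)) u = complex_of_real (exp (- ((a * u)\<^sup>2 / 2))) * char gamma_2_1 (b * u)"
proof -
  interpret prob_space \<Omega> by fact
  have [measurable]: "Y \<in> borel_measurable \<Omega>" "\<Gamma>\<^sub>2 \<in> borel_measurable \<Omega>"
    using indep_var_rv1[OF indep] indep_var_rv2[OF indep] by auto
  show "real_distribution (distr \<Omega> borel (\<lambda>\<omega>. a * Y \<omega> + b * \<Gamma>\<^sub>2 \<omega>))"
    by (rule real_distribution_distr) simp
  have "indep_var borel ((\<lambda>y. a * y) \<circ> Y) borel ((\<lambda>y. b * y) \<circ> \<Gamma>\<^sub>2)"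
    by (rule indep_var_compose[OF indep]) auto
  then have "indep_var borel (\<lambda>\<omega>. a * Y \<omega>) borel (\<lambda>\<omega>. b * \<Gamma>\<^sub>2 \<omega>)" by (simp add: comp_def)
  from char_distr_add[OF this]
  show "char (distr \<Omega> borel (\<lambda>\<omega>. a * Y \<omega> + b * \<Gamma>\<^sub>2 \<omega>)) u = complex_of_real (exp (- ((a * u)\<^sup>2 / 2))) * char gamma_2_1 (b * u)"
    by (simp add: char_distr_scale Y \<Gamma> char_std_normal_distribution)
qed

theorem theorem2p10:
  fixes t :: "nat \<Rightarrow> nat \<Rightarrow> nat"
  assumes "\<And>n. cycle_type n (t n)"
  shows
    "(\<forall>(\<alpha>::ereal) (\<Omega>::'a measure) (Y::'a \<Rightarrow> real) (\<Gamma>\<^sub>2::'a \<Rightarrow> real).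
        0 \<le> \<alpha> \<longrightarrow>
        filterlim (\<lambda>n. nonfixed n (t n)) at_top sequentially \<longrightarrow>
        (\<lambda>n. ereal (real (nonfixed n (t n)) / (real n / sqrt (ln (real n))))) \<longlonglongrightarrow> \<alpha> \<longrightarrow>
        prob_space \<Omega> \<longrightarrow>
        prob_space.indep_var \<Omega> borel Y borel \<Gamma>\<^sub>2 \<longrightarrow>
        distr \<Omega> borel Y = std_normal_distribution \<longrightarrow>
        distr \<Omega> borel \<Gamma>\<^sub>2 = gamma_2_1 \<longrightarrow>
        weak_conv_m
          (\<lambda>n. cyclic_law n (t n)
            (\<lambda>\<tau>. (real (high_records n \<tau>) - ln (real (nonfixed n (t n)))) /
                 (real (t n 1) / real (nonfixed n (t n)) + sqrt (ln (real (nonfixed n (t n)))))))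
          (distr \<Omega> borel (\<lambda>\<omega>. weight_normal \<alpha> * Y \<omega> + weight_gamma \<alpha> * \<Gamma>\<^sub>2 \<omega>)))
     \<and>
     (filterlim (\<lambda>n. real (nonfixed n (t n)) / (real n / sqrt (ln (real n)))) at_top sequentially \<longrightarrow>
        weak_conv_m
          (\<lambda>n. cyclic_law n (t n)
            (\<lambda>\<tau>. (real (high_records n \<tau>) - ln (real n)) / sqrt (ln (real n))))
          std_normal_distribution)"
proof (intro conjI allI impI)
  define m where "m n = nonfixed n (t n)" for n
  have mn: "m n \<le> n" for n by (simp add: m_def nonfixed_def)
  have t1: "real (t n 1) = real (n - m n)" if n: "n \<ge> 1" for n
  proof -
    obtain \<tau> where "\<tau> \<in> cyclic_perms n (t n)" using cyclic_perms_nonempty[OF assms] by blast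
    then have "t n 1 \<le> n" using card_nonfixed(2) n by blast
    then show ?thesis by (simp add: m_def nonfixed_def)
  qed
  {
    fix \<alpha> :: ereal and \<Omega> :: "'a measure" and Y \<Gamma>\<^sub>2 :: "'a \<Rightarrow> real"
    assume \<alpha>: "0 \<le> \<alpha>" and minf: "filterlim (\<lambda>n. nonfixed n (t n)) at_top sequentially"
      and lim: "(\<lambda>n. ereal (real (nonfixed n (t n)) / (real n / sqrt (ln (real n))))) \<longlonglongrightarrow> \<alpha>"
      and \<Omega>: "prob_space \<Omega>" "prob_space.indep_var \<Omega> borel Y borel \<Gamma>\<^sub>2"
        "distr \<Omega> borel Y = std_normal_distribution" "distr \<Omega> borel \<Gamma>\<^sub>2 = gamma_2_1"
    have m: "filterlim m at_top sequentially" using minf by (simp add: m_def[abs_def])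
    define s where "s n = real (t n 1) / real (m n) + sqrt (ln (real (m n)))" for n
    define L where "L n = sqrt (ln (real (m n)))" for n
    have L: "filterlim L at_top sequentially" unfolding L_def[abs_def] by (rule sqrt_ln_at_top_compose[OF m])
    have s: "filterlim s at_top sequentially"
      by (rule filterlim_at_top_mono[OF L]) (auto simp: s_def L_def)
    have s_eq: "eventually (\<lambda>n. s n = real (n - m n) / real (m n) + L n) sequentially"
      using eventually_ge_at_top[of 1] by eventually_elim (simp only: s_def t1 L_def)
    have w0: "(\<lambda>n. L n / (real (n - m n) / real (m n) + L n)) \<longlonglongrightarrow> weight_normal \<alpha>"
      unfolding L_def using lim by (intro normal_weight_limit[OF mn m \<alpha>]) (simp add: m_def)
    have w: "(\<lambda>n. L n / s n) \<longlonglongrightarrow> weight_normal \<alpha>"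
      by (rule Lim_transform_eventually[OF w0]) (use s_eq in eventually_elim, simp)
    have "1 - weight_normal \<alpha> = weight_gamma \<alpha>"
    proof (cases "\<alpha> = \<infinity>")
      case False
      then obtain a where "\<alpha> = ereal a" "a \<ge> 0" using \<alpha> by (cases \<alpha>) auto
      then show ?thesis by (simp add: weight_normal_def weight_gamma_def field_simps)
    qed (simp add: weight_normal_def weight_gamma_def)
    then have g1: "(\<lambda>n. 1 - L n / s n) \<longlonglongrightarrow> weight_gamma \<alpha>"
      using tendsto_diff[OF tendsto_const w, of 1] by simp
    have "eventually (\<lambda>n. s n > 0) sequentially" using s by (simp add: filterlim_at_top_dense)
    with s_eq have "eventually (\<lambda>n. 1 - L n / s n = real (n - m n) / real (m n) / s n) sequentially"
    proof eventually_elim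
      case (elim n)
      then have "real (n - m n) / real (m n) = s n - L n" by simp
      moreover have "1 - L n / s n = (s n - L n) / s n" using elim(2) by (simp only: diff_divide_distrib) simp
      ultimately show ?case by (simp only:)
    qed
    then have g: "(\<lambda>n. real (n - m n) / real (m n) / s n) \<longlonglongrightarrow> weight_gamma \<alpha>"
      by (rule Lim_transform_eventually[OF g1])
    have "(\<lambda>n. char (cyclic_law n (t n) (\<lambda>\<tau>. (real (high_records n \<tau>) - ln (real (m n))) / s n)) u)
        \<longlonglongrightarrow> char (distr \<Omega> borel (\<lambda>\<omega>. weight_normal \<alpha> * Y \<omega> + weight_gamma \<alpha> * \<Gamma>\<^sub>2 \<omega>)) u" for u
      unfolding char_normal_gamma_combination(2)[OF \<Omega>]
      using m s w g unfolding L_def m_def by (intro char_cyclic_law_limit assms) auto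
    then have "weak_conv_m (\<lambda>n. cyclic_law n (t n) (\<lambda>\<tau>. (real (high_records n \<tau>) - ln (real (m n))) / s n))
        (distr \<Omega> borel (\<lambda>\<omega>. weight_normal \<alpha> * Y \<omega> + weight_gamma \<alpha> * \<Gamma>\<^sub>2 \<omega>))"
      by (intro levy_continuity real_distribution_cyclic_law char_normal_gamma_combination(1)[OF \<Omega>])
    then show "weak_conv_m
          (\<lambda>n. cyclic_law n (t n)
            (\<lambda>\<tau>. (real (high_records n \<tau>) - ln (real (nonfixed n (t n)))) /
                 (real (t n 1) / real (nonfixed n (t n)) + sqrt (ln (real (nonfixed n (t n)))))))
          (distr \<Omega> borel (\<lambda>\<omega>. weight_normal \<alpha> * Y \<omega> + weight_gamma \<alpha> * \<Gamma>\<^sub>2 \<omega>))"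
      unfolding s_def m_def .
  }
  assume "filterlim (\<lambda>n. real (nonfixed n (t n)) / (real n / sqrt (ln (real n)))) at_top sequentially"
  then have x: "filterlim (\<lambda>n. real (m n) / (real n / sqrt (ln (real n)))) at_top sequentially"
    by (simp add: m_def)
  have c: "eventually (\<lambda>n. real (m n) / (real n / sqrt (ln (real n))) \<ge> 1) sequentially"
    using x by (simp add: filterlim_at_top)
  have "filterlim (\<lambda>n. real (m n)) at_top sequentially"
  proof (rule filterlim_at_top_mono)
    show "filterlim (\<lambda>n. real n / sqrt (ln (real n))) at_top sequentially" by real_asymp
    show "\<forall>\<^sub>F n in sequentially. real n / sqrt (ln (real n)) \<le> real (m n)"
      using c eventually_ge_at_top[of 3] by eventually_elim (simp add: field_simps)
  qed
  then have m: "filterlim m at_top sequentially"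
    unfolding filterlim_at_top by (metis (mono_tags, lifting) eventually_mono of_nat_le_iff)
  have s: "filterlim (\<lambda>n. sqrt (ln (real n))) at_top sequentially" by real_asymp
  have g: "(\<lambda>n. real (n - m n) / real (m n) / sqrt (ln (real n))) \<longlonglongrightarrow> 0"
  proof (rule real_tendsto_sandwich[OF _ _ tendsto_const real_tendsto_divide_at_top[OF tendsto_const[of 1] x]])
    show "\<forall>\<^sub>F n in sequentially. 0 \<le> real (n - m n) / real (m n) / sqrt (ln (real n))"
      using eventually_ge_at_top[of 1] by eventually_elim simp
    show "\<forall>\<^sub>F n in sequentially. real (n - m n) / real (m n) / sqrt (ln (real n)) \<le> 1 / (real (m n) / (real n / sqrt (ln (real n))))"
      using eventually_ge_at_top[of 3]
    proof eventually_elim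
      case (elim n)
      have "real (n - m n) / real (m n) / sqrt (ln (real n)) \<le> real n / real (m n) / sqrt (ln (real n))"
        using elim by (intro divide_right_mono) auto
      then show ?case by simp
    qed
  qed
  have "(\<lambda>n. char (cyclic_law n (t n) (\<lambda>\<tau>. (real (high_records n \<tau>) - ln (real n)) / sqrt (ln (real n)))) u)
      \<longlonglongrightarrow> complex_of_real (exp (- ((1 * u)\<^sup>2 / 2))) * char gamma_2_1 (0 * u)" for u
    using m s g sqrt_ln_nonfixed_ratio[OF mn m zero_less_one c] ln_nonfixed_close[OF mn m zero_less_one c]
    unfolding m_def by (intro char_cyclic_law_limit assms)
  moreover have "char gamma_2_1 0 = 1"
    using real_distribution_gamma_2_1 by (simp add: real_distribution.char_zero)
  ultimately show "weak_conv_m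
          (\<lambda>n. cyclic_law n (t n)
            (\<lambda>\<tau>. (real (high_records n \<tau>) - ln (real n)) / sqrt (ln (real n))))
          std_normal_distribution"
    by (intro levy_continuity real_distribution_cyclic_law real_dist_normal_dist)
      (simp add: char_std_normal_distribution)
qed

end
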